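(* Let $R$ be any parameterized problem. Suppose that there is a linear OR composition from some NP-hard classical problem $L$ to $R$. Then, unless $\mathrm{NP}\subseteq\mathrm{coNP}/\mathrm{poly}$, $R$ admits no polynomial-size Turing kernel with $O(n^{1-\varepsilon})$ queries, for any $\varepsilon>0$, where $n$ is the size of the input instance.
   Context: A classical problem is a subset of $\{0,1\}^*$; a parameterized problem is a subset of $\{0,1\}^*\times\mathbb{N}$, and for an instance $(y,p)$, $|(y,p)|:=|y|+p+c_0$ for a fixed constant $c_0$. A linear OR composition from $L$ to $R$ is an algorithm that takes $t$ instances $x_1,\dots,x_t$ of $L$ and computes in time $\mathrm{poly}(\sum_i|x_i|)$ an instance $(y,p)$ of $R$ such that (i) $|(y,p)| = t\cdot\mathrm{poly}(\log t)\cdot\mathrm{poly}(\max_i|x_i|)$, (ii) $p=\mathrm{poly}(\max_i|x_i|+\log t)$, and (iii) $(y,p)\in R$ iff $x_i\in L$ for some $i$. A Turing kernel for $R$ is an algorithm with oracle access to $R$ that on input $(x,p)$ correctly decides in polynomial time whether $(x,p)\in R$, using only queries "$(y,p')\in R$?" with $|y|+p'\le f(p)$ for a computable $f$; it is polynomial-size if $f$ is a polynomial, and the number of queries is measured as a function of the input size $n$. *)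

theory Defs
  imports
    Complex_Main
    "HOL-Computational_Algebra.Polynomial"
    "HOL-Library.Landau_Symbols"
begin

type_synonym bitstring = "bool list"
type_synonym problem = "bitstring set"
type_synonym param_inst = "bitstring \<times> nat"
type_synonym param_problem = "param_inst set"

definition size_inst :: "nat \<Rightarrow> param_inst \<Rightarrow> nat" where
  "size_inst c0 = (\<lambda>(y, p). length y + p + c0)"


section \<open>Model of computation\<close>

text \<open>
  Algorithms are structured programs over finitely many binary stacks (the registers that occur
  in the program text), each elementary instruction taking one time unit. A stack is one half of a
  Turing machine tape, so up to a polynomial (in fact constant) factor in the running time these
  are the deterministic multi-tape Turing machines. No instruction copies or compares whole
  registers; hence a run of length \<open>t\<close> adds at most \<open>t\<close> bits to the memory. (The answer to a query
  is a single bit.)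

  A register represents a natural number in unary, by its length; this agrees with
  the parameter \<open>p\<close> contributing \<open>p\<close> to the size of an instance.
\<close>

datatype com =
    Skip
  | Push nat bool
  | Pop nat
  | Seq com com
  | Branch nat com com com  \<comment> \<open>top symbol 1 / top symbol 0 / register empty\<close>
  | While nat com           \<comment> \<open>loop as long as the register is nonempty\<close>
  | Query nat nat nat       \<comment> \<open>registers holding the string, the parameter, and the answer\<close>

type_synonym store = "nat \<Rightarrow> bitstring"

text \<open>
  \<open>exec R c s t qs s'\<close>: with oracle \<open>R\<close>, program \<open>c\<close> started in \<open>s\<close> halts in \<open>s'\<close> after \<open>t\<close> steps,
  and \<open>qs\<close> is the list of queries it asks, in order and with repetitions.
\<close>

inductive exec ::
  "param_problem \<Rightarrow> com \<Rightarrow> store \<Rightarrow> nat \<Rightarrow> param_inst list \<Rightarrow> store \<Rightarrow> bool" for R where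
  Skip: "exec R Skip s 1 [] s"
| Push: "exec R (Push r b) s 1 [] (s(r := b # s r))"
| Pop: "exec R (Pop r) s 1 [] (s(r := tl (s r)))"
| Seq: "exec R c1 s t1 qs1 s1 \<Longrightarrow> exec R c2 s1 t2 qs2 s2
    \<Longrightarrow> exec R (Seq c1 c2) s (t1 + t2) (qs1 @ qs2) s2"
| Branch: "exec R (case s r of [] \<Rightarrow> c3 | b # _ \<Rightarrow> if b then c1 else c2) s t qs s'
    \<Longrightarrow> exec R (Branch r c1 c2 c3) s (Suc t) qs s'"
| While_end: "s r = [] \<Longrightarrow> exec R (While r c) s 1 [] s"
| While_step: "s r \<noteq> [] \<Longrightarrow> exec R c s t1 qs1 s1 \<Longrightarrow> exec R (While r c) s1 t2 qs2 s2
    \<Longrightarrow> exec R (While r c) s (Suc (t1 + t2)) (qs1 @ qs2) s2"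
| Query: "exec R (Query y p a) s 1 [(s y, length (s p))]
    (s(a := [(s y, length (s p)) \<in> R]))"

lemma exec_deterministic:
  assumes "exec R c s t qs s'" and "exec R c s t2 qs2 s2"
  shows "t2 = t \<and> qs2 = qs \<and> s2 = s'"
  using assms
proof (induction arbitrary: t2 qs2 s2 rule: exec.induct)
  case (Seq c1 s t1 qs1 s1 c2 t2' qs2' s2')
  from Seq.prems show ?case by cases (use Seq.IH in blast)
next
  case (Branch s r c3 c1 c2 t qs s')
  from Branch.prems show ?case by cases (use Branch.IH in blast)
next
  case (While_step s r c t1 qs1 s1 t2' qs2' s2')
  from While_step.prems show ?case
    by cases (use While_step.hyps While_step.IH in blast)+
qed (auto elim: exec.cases)

definition load :: "bitstring list \<Rightarrow> store" where
  "load xs = (\<lambda>r. if r < length xs then xs ! r else [])"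

definition unary :: "nat \<Rightarrow> bitstring" where
  "unary n = replicate n True"

text \<open>
  Ordinary computation: a run that asks no queries at all, so that the oracle argument of
  \<open>exec\<close> is irrelevant.
\<close>

definition runs :: "com \<Rightarrow> store \<Rightarrow> nat \<Rightarrow> store \<Rightarrow> bool" where
  "runs c s t s' \<longleftrightarrow> exec {} c s t [] s'"

definition computable_nat :: "(nat \<Rightarrow> nat) \<Rightarrow> bool" where
  "computable_nat f \<longleftrightarrow> (\<exists>c. \<forall>n. \<exists>t s'. runs c (load [unary n]) t s' \<and> length (s' 0) = f n)"

definition polytime_computable :: "(bitstring \<Rightarrow> bitstring) \<Rightarrow> bool" where
  "polytime_computable f \<longleftrightarrow> (\<exists>c (q :: nat poly). \<forall>x. \<exists>t s'.
     runs c (load [x]) t s' \<and> t \<le> poly q (length x) \<and> s' 0 = f x)"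

text \<open>
  Self-delimiting encodings of pairs and lists: every bit of the first component is preceded by a
  1, and a 0 marks its end.
\<close>

definition pair :: "bitstring \<Rightarrow> bitstring \<Rightarrow> bitstring" where
  "pair x y = concat (map (\<lambda>b. [True, b]) x) @ False # y"

definition encode_list :: "bitstring list \<Rightarrow> bitstring" where
  "encode_list xs = foldr pair xs []"


section \<open>Complexity classes\<close>

definition class_P :: "problem set" where
  "class_P = {L. polytime_computable (\<lambda>x. [x \<in> L])}"

definition class_NP :: "problem set" where
  "class_NP = {L. \<exists>V \<in> class_P. \<exists>q :: nat poly.
     \<forall>x. x \<in> L \<longleftrightarrow> (\<exists>w. length w \<le> poly q (length x) \<and> pair x w \<in> V)}"

definition class_coNP :: "problem set" where
  "class_coNP = {L. - L \<in> class_NP}"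

definition with_poly_advice :: "problem set \<Rightarrow> problem set" where
  "with_poly_advice C = {L. \<exists>A \<in> C. \<exists>(a :: nat \<Rightarrow> bitstring) (q :: nat poly).
     (\<forall>n. length (a n) \<le> poly q n) \<and> (\<forall>x. x \<in> L \<longleftrightarrow> pair x (a (length x)) \<in> A)}"

definition karp_reducible :: "problem \<Rightarrow> problem \<Rightarrow> bool" where
  "karp_reducible A B \<longleftrightarrow> (\<exists>f. polytime_computable f \<and> (\<forall>x. x \<in> A \<longleftrightarrow> f x \<in> B))"

definition NP_hard :: "problem \<Rightarrow> bool" where
  "NP_hard L \<longleftrightarrow> (\<forall>A \<in> class_NP. karp_reducible A L)"


section \<open>Linear OR compositions\<close>

text \<open>
  \<open>g\<close> is the function computed by the composition. The time bound is polynomial in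
  \<open>\<Sum>(|x\<^sub>i| + 1)\<close>, i.e. in the size of the encoded input, so that empty strings among the
  \<open>x\<^sub>i\<close> are not free. The unspecified functions \<open>poly(\<dots>)\<close> are upper bounds by polynomials.
\<close>

definition linear_OR_composition ::
  "nat \<Rightarrow> problem \<Rightarrow> param_problem \<Rightarrow> (bitstring list \<Rightarrow> param_inst) \<Rightarrow> bool" where
  "linear_OR_composition c0 L R g \<longleftrightarrow>
     (\<exists>c (q :: nat poly). \<forall>xs. xs \<noteq> [] \<longrightarrow> (\<exists>t s'.
        runs c (load [encode_list xs]) t s' \<and> t \<le> poly q (\<Sum>x\<leftarrow>xs. length x + 1) \<and>
        g xs = (s' 0, length (s' 1)))) \<and>
     (\<exists>a b :: real poly. \<forall>xs. xs \<noteq> [] \<longrightarrow>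
        real (size_inst c0 (g xs))
          \<le> real (length xs) * poly a (log 2 (real (length xs)))
             * poly b (real (Max (length ` set xs)))) \<and>
     (\<exists>a :: real poly. \<forall>xs. xs \<noteq> [] \<longrightarrow>
        real (snd (g xs)) \<le> poly a (real (Max (length ` set xs)) + log 2 (real (length xs)))) \<and>
     (\<forall>xs. xs \<noteq> [] \<longrightarrow> (g xs \<in> R \<longleftrightarrow> (\<exists>x \<in> set xs. x \<in> L)))"


section \<open>Turing kernels\<close>

definition load_inst :: "param_inst \<Rightarrow> store" where
  "load_inst = (\<lambda>(x, p). load [x, unary p])"

definition turing_kernel ::
  "nat \<Rightarrow> param_problem \<Rightarrow> com \<Rightarrow> (nat \<Rightarrow> nat) \<Rightarrow> bool" where
  "turing_kernel c0 R K f \<longleftrightarrow> computable_nat f \<and>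
     (\<exists>q :: nat poly. \<forall>x p. \<exists>t qs s'.
        exec R K (load_inst (x, p)) t qs s' \<and> t \<le> poly q (size_inst c0 (x, p)) \<and>
        s' 0 = [(x, p) \<in> R] \<and>
        (\<forall>(y, p') \<in> set qs. length y + p' \<le> f p))"

definition is_polynomial :: "(nat \<Rightarrow> nat) \<Rightarrow> bool" where
  "is_polynomial f \<longleftrightarrow> (\<exists>q :: real poly. \<forall>n. real (f n) = poly q (real n))"

text \<open>On inputs of size \<open>n\<close>, the program asks at most \<open>b n\<close> queries.\<close>

definition query_bound ::
  "nat \<Rightarrow> param_problem \<Rightarrow> com \<Rightarrow> (nat \<Rightarrow> real) \<Rightarrow> bool" where
  "query_bound c0 R K b \<longleftrightarrow> (\<forall>x p t qs s'.
     exec R K (load_inst (x, p)) t qs s' \<longrightarrow> real (length qs) \<le> b (size_inst c0 (x, p)))"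

end

theory Submission
  imports Defs
begin

text \<open>
  Let \<open>A\<close> be in NP and let \<open>f\<close> reduce \<open>A\<close> to \<open>L\<close>. Composing \<open>t\<close> strings \<open>f x\<^sub>1, \<dots>, f x\<^sub>t\<close> with
  \<open>x\<^sub>i \<notin> A\<close> of length \<open>n\<close> and running the kernel on the result produces a transcript: the
  list of queries together with their answers. If \<open>t\<close> is a large enough polynomial in \<open>n\<close>, the
  bound on the number of queries makes the transcript shorter than \<open>t\<close> bits, so there are less than
  \<open>2\<^sup>t\<close> transcripts. As \<open>|S|\<^sup>t \<le> \<Sum>\<^sub>u |C\<^sub>u|\<^sup>t\<close>, where \<open>C\<^sub>u\<close> is the set of strings
  that occur in a tuple over \<open>S\<close> with transcript \<open>u\<close>, some transcript covers half of \<open>S\<close>, hence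
  \<open>n + 1\<close> transcripts cover all strings of length \<open>n\<close> outside \<open>A\<close>. They form the advice
  (the complementary witness lemma of Dell and van Melkebeek). A certificate for \<open>x \<notin> A\<close> is a
  transcript of the advice and a list containing \<open>f x\<close> on which the kernel, with its queries
  answered from the transcript, rejects. The answers recorded in the advice are true, so for
  \<open>x \<in> A\<close> no certificate exists, whatever the list.

  A program that runs with a transcript not meant for it may diverge. The verifier
  therefore runs a version of the program that is driven by a clock, and the clock is part of the certificate.
\<close>

section \<open>Runs of programs\<close>

inductive_simps exec_Skip_iff [simp]: "exec R Skip s t qs s'"
inductive_simps exec_Push_iff [simp]: "exec R (Push r b) s t qs s'"
inductive_simps exec_Pop_iff [simp]: "exec R (Pop r) s t qs s'"
inductive_simps exec_Seq_iff [simp]: "exec R (Seq c1 c2) s t qs s'"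
inductive_simps exec_Branch_iff [simp]: "exec R (Branch r c1 c2 c3) s t qs s'"
inductive_simps exec_Query_iff [simp]: "exec R (Query y p a) s t qs s'"
\<comment> \<open>Kept out of the simplifier, since the right-hand side contains the same loop
  again. The next two lemmas unfold a loop only when the test of its register is decided.\<close>
inductive_simps exec_While_iff: "exec R (While r c) s t qs s'"

lemma exec_While_Nil [simp]:
  "s r = [] \<Longrightarrow> exec R (While r c) s t qs s' \<longleftrightarrow> t = 1 \<and> qs = [] \<and> s' = s"
  by (subst exec_While_iff) auto

lemma exec_While_Cons:
  "s r \<noteq> [] \<Longrightarrow> exec R (While r c) s t qs s' \<longleftrightarrow>
     (\<exists>t1 qs1 s1 t2 qs2. t = Suc (t1 + t2) \<and> qs = qs1 @ qs2 \<and>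
        exec R c s t1 qs1 s1 \<and> exec R (While r c) s1 t2 qs2 s')"
  by (subst exec_While_iff) auto

text \<open>By determinism a single known run describes all runs. This turns facts such as
  \<open>exec_move\<close> into equivalences.\<close>

lemma exec_iff:
  assumes "exec R c s t qs s'"
  shows "exec R c s t2 qs2 s2 \<longleftrightarrow> t2 = t \<and> qs2 = qs \<and> s2 = s'"
  using exec_deterministic[OF assms] assms by blast

text \<open>Turns every time bound into a bound on output lengths: for the reduction, the
  composition and the guessed lists.\<close>

lemma exec_length_le: "exec R c s t qs s' \<Longrightarrow> length (s' r) \<le> length (s r) + t"
proof (induction rule: exec.induct)
  case (Push s)
  then show ?case by simp
qed (auto split: list.splits if_splits)

lemma exec_time_pos: "exec R c s t qs s' \<Longrightarrow> t > 0"
  by (induction rule: exec.induct) auto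

section \<open>Programs on renamed registers\<close>

primrec rename :: "(nat \<Rightarrow> nat) \<Rightarrow> com \<Rightarrow> com" where
  "rename \<rho> Skip = Skip"
| "rename \<rho> (Push r b) = Push (\<rho> r) b"
| "rename \<rho> (Pop r) = Pop (\<rho> r)"
| "rename \<rho> (Seq c1 c2) = Seq (rename \<rho> c1) (rename \<rho> c2)"
| "rename \<rho> (Branch r c1 c2 c3) = Branch (\<rho> r) (rename \<rho> c1) (rename \<rho> c2) (rename \<rho> c3)"
| "rename \<rho> (While r c) = While (\<rho> r) (rename \<rho> c)"
| "rename \<rho> (Query y p a) = Query (\<rho> y) (\<rho> p) (\<rho> a)"

text \<open>For running the reduction, the composition and the kernel in disjoint banks of one
  store. Injectivity keeps an update of one register from showing in another one.\<close>

lemma exec_rename: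
  assumes "inj \<rho>" and "exec R c s t qs s'" and "s = S \<circ> \<rho>"
  shows "\<exists>S'. exec R (rename \<rho> c) S t qs S' \<and> S' \<circ> \<rho> = s' \<and> (\<forall>r. r \<notin> range \<rho> \<longrightarrow> S' r = S r)"
  using assms(2,3)
proof (induction arbitrary: S rule: exec.induct)
  case (Seq c1 s t1 qs1 s1 c2 t2 qs2 s2)
  then obtain S1 where S1: "exec R (rename \<rho> c1) S t1 qs1 S1" "S1 \<circ> \<rho> = s1"
      "\<And>r. r \<notin> range \<rho> \<Longrightarrow> S1 r = S r" by blast
  with Seq.IH(2)[of S1] obtain S2 where S2: "exec R (rename \<rho> c2) S1 t2 qs2 S2"
      "S2 \<circ> \<rho> = s2" "\<And>r. r \<notin> range \<rho> \<Longrightarrow> S2 r = S1 r" by blast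
  from exec.Seq[OF S1(1) S2(1)] have "exec R (rename \<rho> (Seq c1 c2)) S (t1 + t2) (qs1 @ qs2) S2"
    by (simp del: exec_Seq_iff)
  with S1 S2 show ?case by metis
next
  case (Branch s r c3 c1 c2 t qs s')
  have "(case S (\<rho> r) of [] \<Rightarrow> rename \<rho> c3 | b # _ \<Rightarrow> if b then rename \<rho> c1 else rename \<rho> c2) =
      rename \<rho> (case s r of [] \<Rightarrow> c3 | b # _ \<Rightarrow> if b then c1 else c2)"
    using Branch.prems by (auto split: list.split)
  with Branch.IH[OF Branch.prems] show ?case by simp
next
  case (While_end s r c)
  then show ?case by auto
next
  case (While_step s r c t1 qs1 s1 t2 qs2 s2)
  then obtain S1 where S1: "exec R (rename \<rho> c) S t1 qs1 S1" "S1 \<circ> \<rho> = s1"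
      "\<And>r. r \<notin> range \<rho> \<Longrightarrow> S1 r = S r" by blast
  with While_step.IH(2)[of S1] obtain S2 where S2: "exec R (rename \<rho> (While r c)) S1 t2 qs2 S2"
      "S2 \<circ> \<rho> = s2" "\<And>r. r \<notin> range \<rho> \<Longrightarrow> S2 r = S1 r" by blast
  have "S (\<rho> r) \<noteq> []" using While_step by auto
  with S1(1) S2(1) have "exec R (rename \<rho> (While r c)) S (Suc (t1 + t2)) (qs1 @ qs2) S2"
    by (auto intro: exec.While_step)
  with S1 S2 show ?case by auto
next
  case (Query y p a s)
  then show ?case using assms(1) by (simp add: comp_def) (auto simp: fun_eq_iff inj_eq)
next
  case (Push r b s)
  then show ?case using assms(1) by (simp add: comp_def) (auto simp: fun_eq_iff inj_eq)
next
  case (Pop r s)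
  then show ?case using assms(1) by (simp add: comp_def) (auto simp: fun_eq_iff inj_eq)
qed auto

text \<open>For embedding ordinary computations, which are defined with the empty oracle, into
  programs with oracle \<open>R\<close>.\<close>

lemma exec_no_query_oracle: "exec R c s t qs s' \<Longrightarrow> qs = [] \<Longrightarrow> exec R' c s t [] s'"
proof (induction rule: exec.induct)
  case (While_end s r c) then show ?case by simp
next
  case (While_step s r c t1 qs1 s1 t2 qs2 s2)
  then show ?case using exec.While_step[of s r R' c t1 "[]" s1 t2 "[]" s2] by simp
qed (auto, (metis append_Nil)?)

text \<open>Failure is expressed by divergence, so a guess is good if and only if a run exists. The
  clock later makes this decidable.\<close>

definition diverge :: com where
  "diverge = Seq (Push 0 True) (While 0 Skip)"

lemma no_exec_diverge [simp]: "\<not> exec R diverge s t qs s'"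
proof -
  have "exec R c s t qs s' \<Longrightarrow> c = While 0 Skip \<Longrightarrow> s 0 = []" for c s t qs s'
    by (induction rule: exec.induct) auto
  then show ?thesis by (fastforce simp: diverge_def)
qed

section \<open>Stack operations, loops driven by a string, and coding of pairs\<close>

definition move_bit :: "nat \<Rightarrow> nat \<Rightarrow> com" where
  "move_bit a b = Branch a (Seq (Pop a) (Push b True)) (Seq (Pop a) (Push b False)) Skip"

definition move :: "nat \<Rightarrow> nat \<Rightarrow> com" where
  "move a b = While a (move_bit a b)"

definition clear :: "nat \<Rightarrow> com" where
  "clear a = While a (Pop a)"

lemma exec_move_bit:
  "a \<noteq> b \<Longrightarrow> s a = x # xs \<Longrightarrow> exec R (move_bit a b) s 3 [] (s(a := xs, b := x # s b))"
  by (simp add: move_bit_def fun_upd_twist)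

lemma exec_move:
  assumes "a \<noteq> b"
  shows "exec R (move a b) s (4 * length (s a) + 1) [] (s(a := [], b := rev (s a) @ s b))"
proof (induction "s a" arbitrary: s)
  case Nil
  then show ?case by (auto simp: move_def fun_eq_iff)
next
  case (Cons x xs)
  let ?s = "s(a := xs, b := x # s b)"
  have 1: "exec R (move_bit a b) s 3 [] ?s" using Cons assms by (intro exec_move_bit) auto
  have 2: "exec R (move a b) ?s (4 * length xs + 1) [] (?s(a := [], b := rev xs @ ?s b))"
    using Cons(1)[of ?s] assms by simp
  have 3: "?s(a := [], b := rev xs @ ?s b) = s(a := [], b := rev (s a) @ s b)"
    using Cons(2)[symmetric] assms by (auto simp: fun_eq_iff)
  from exec.While_step[OF _ 1 2[unfolded move_def]] Cons(2)[symmetric]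
  show ?case unfolding 3 move_def by simp
qed

lemma exec_clear: "exec R (clear a) s (2 * length (s a) + 1) [] (s(a := []))"
proof (induction "s a" arbitrary: s)
  case Nil
  then have "s(a := []) = s" by (metis fun_upd_triv)
  with Nil show ?case by (simp add: clear_def)
next
  case (Cons x xs)
  have 1: "exec R (Pop a) s 1 [] (s(a := xs))" using Cons(2)[symmetric] by simp
  have 2: "exec R (clear a) (s(a := xs)) (2 * length xs + 1) [] (s(a := []))"
    using Cons(1)[of "s(a := xs)"] by simp
  from exec.While_step[OF _ 1 2[unfolded clear_def]] Cons(2)[symmetric]
  show ?case unfolding clear_def by simp
qed

text \<open>\<open>While\<close> tests only for emptiness. A loop governed by the next symbol of
  \<open>r\<close> therefore needs a flag \<open>f\<close>, which becomes nonempty when a 1 has been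
  read.\<close>

definition read_bit :: "nat \<Rightarrow> nat \<Rightarrow> com" where
  "read_bit f r = Branch r (Seq (Pop r) (Push f True)) (Pop r) Skip"

definition while_bit :: "nat \<Rightarrow> nat \<Rightarrow> com \<Rightarrow> com" where
  "while_bit f r c = Seq (read_bit f r) (While f (Seq (Pop f) (Seq c (read_bit f r))))"

lemma exec_while_bit_stop:
  assumes "s f = []" "f \<noteq> r" "s r = [] \<or> (\<exists>v. s r = False # v)"
  shows "exec R (while_bit f r c) s 3 [] (s(r := tl (s r)))"
proof -
  let ?s1 = "s(r := tl (s r))"
  have 1: "exec R (read_bit f r) s 2 [] ?s1"
    using assms(3) by (auto simp: read_bit_def fun_eq_iff)
  have 2: "exec R (While f (Seq (Pop f) (Seq c (read_bit f r)))) ?s1 1 [] ?s1"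
    using assms by simp
  from exec.Seq[OF 1 2] show ?thesis unfolding while_bit_def by (simp del: exec_Seq_iff)
qed

lemma exec_while_bit_step:
  assumes "s f = []" "f \<noteq> r" "s r = True # v"
    and "exec R c (s(r := v)) t1 qs1 s1" and "exec R (while_bit f r c) s1 t2 qs2 s2"
  shows "exec R (while_bit f r c) s (t1 + t2 + 5) (qs1 @ qs2) s2"
proof -
  let ?W = "While f (Seq (Pop f) (Seq c (read_bit f r)))"
  have read: "exec R (read_bit f r) s 3 [] (s(r := v, f := [True]))"
    using assms(1-3) by (simp add: read_bit_def)
  \<comment> \<open>The \<open>read_bit\<close> that opens the remaining loop is the one that closes
    the current iteration.\<close>
  obtain t3 qs3 s3 t4 qs4 where split: "exec R (read_bit f r) s1 t3 qs3 s3"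
      "exec R ?W s3 t4 qs4 s2" "t2 = t3 + t4" "qs2 = qs3 @ qs4"
    using assms(5) unfolding while_bit_def exec_Seq_iff by blast
  have "(s(r := v, f := [True]))(f := tl ((s(r := v, f := [True])) f)) = s(r := v)"
    using assms(1,2) by (auto simp: fun_eq_iff)
  then have "exec R (Pop f) (s(r := v, f := [True])) 1 [] (s(r := v))" by simp
  from exec.Seq[OF this exec.Seq[OF assms(4) split(1)]]
  have "exec R (Seq (Pop f) (Seq c (read_bit f r))) (s(r := v, f := [True])) (1 + (t1 + t3))
    ([] @ qs1 @ qs3) s3" .
  from exec.While_step[OF _ this split(2)]
  have "exec R ?W (s(r := v, f := [True])) (Suc (1 + (t1 + t3) + t4)) (([] @ qs1 @ qs3) @ qs4) s2"
    by simp
  from exec.Seq[OF read this] show ?thesis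
    unfolding while_bit_def split(3,4) by (simp add: algebra_simps del: exec_Seq_iff)
qed

text \<open>Total on malformed input: a string that breaks off counts as ended.\<close>
fun split_pair :: "bitstring \<Rightarrow> bitstring \<times> bitstring" where
  "split_pair (True # b # v) = (b # fst (split_pair v), snd (split_pair v))"
| "split_pair (False # v) = ([], v)"
| "split_pair [True] = ([], [])"
| "split_pair [] = ([], [])"

lemma split_pair_pair [simp]: "split_pair (pair x y) = (x, y)"
  by (induction x) (auto simp: pair_def)

lemma length_split_pair: "2 * length (fst (split_pair v)) + length (snd (split_pair v)) \<le> length v"
  by (induction v rule: split_pair.induct) auto

definition unpair :: "nat \<Rightarrow> nat \<Rightarrow> nat \<Rightarrow> com" where
  "unpair f a b = while_bit f a (move_bit a b)"

text \<open>The first component arrives reversed, being carried from stack to stack; a later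
  \<open>move\<close> or \<open>push_pair\<close> restores its order.\<close>

lemma exec_unpair:
  assumes "s f = []" "f \<noteq> a" "f \<noteq> b" "a \<noteq> b"
  shows "\<exists>t \<le> 8 * length (s a) + 3.
    exec R (unpair f a b) s t [] (s(a := snd (split_pair (s a)), b := rev (fst (split_pair (s a))) @ s b))"
  using assms(1)
proof (induction "s a" arbitrary: s rule: split_pair.induct)
  case (1 x v s)
  let ?s1 = "s(a := v, b := x # s b)"
  have "exec R (move_bit a b) (s(a := x # v)) 3 [] ((s(a := x # v))(a := v, b := x # (s(a := x # v)) b))"
    using assms by (intro exec_move_bit) auto
  then have move: "exec R (move_bit a b) (s(a := x # v)) 3 [] ?s1"
    using assms by simp
  have pre: "v = ?s1 a" "?s1 f = []" using 1(4) assms by auto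
  from 1(1)[OF pre, folded pre(1)] obtain t where t: "t \<le> 8 * length v + 3"
    "exec R (unpair f a b) ?s1 t [] (?s1(a := snd (split_pair v), b := rev (fst (split_pair v)) @ ?s1 b))"
    by blast
  have eq: "?s1(a := snd (split_pair v), b := rev (fst (split_pair v)) @ ?s1 b) =
     s(a := snd (split_pair (s a)), b := rev (fst (split_pair (s a))) @ s b)"
    using assms 1(3)[symmetric] by (auto simp: fun_eq_iff)
  from exec_while_bit_step[OF _ _ _ move t(2)[unfolded unpair_def eq]] assms 1(3)[symmetric] 1(4)
  show ?case unfolding unpair_def using t(1) by (intro exI[of _ "3 + t + 5"]) simp
next
  case (2 v s)
  have "exec R (unpair f a b) s 3 [] (s(a := tl (s a)))"
    unfolding unpair_def using assms 2 by (intro exec_while_bit_stop) (auto simp: eq_commute[of _ "s a"])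
  moreover have "s(a := tl (s a)) = s(a := snd (split_pair (s a)), b := rev (fst (split_pair (s a))) @ s b)"
    using 2(1)[symmetric] assms by (auto simp: fun_eq_iff)
  ultimately show ?case by (intro exI[of _ 3] conjI, linarith, simp only:)
next
  case (3 s)
  \<comment> \<open>A 1 with no bit behind it: the iteration finds the register empty and moves
    nothing, and then the loop stops.\<close>
  have move: "exec R (move_bit a b) (s(a := [])) 2 [] (s(a := []))"
    by (simp add: move_bit_def)
  have stop: "exec R (while_bit f a (move_bit a b)) (s(a := [])) 3 [] (s(a := []))"
    using exec_while_bit_stop[of "s(a := [])" f a R "move_bit a b"] assms 3 by simp
  from exec_while_bit_step[OF _ _ _ move stop] assms 3(1)[symmetric] 3(2)
  have "exec R (unpair f a b) s 10 [] (s(a := []))" unfolding unpair_def by simp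
  moreover have "s(a := []) = s(a := snd (split_pair (s a)), b := rev (fst (split_pair (s a))) @ s b)"
    using 3(1)[symmetric] assms by (auto simp: fun_eq_iff)
  moreover have "10 \<le> 8 * length (s a) + 3" using 3(1)[symmetric] by simp
  ultimately show ?case by (intro exI[of _ 10] conjI, linarith, simp only:)
next
  case (4 s)
  have "exec R (unpair f a b) s 3 [] (s(a := tl (s a)))"
    unfolding unpair_def using assms 4 by (intro exec_while_bit_stop) auto
  moreover have "s(a := tl (s a)) = s(a := snd (split_pair (s a)), b := rev (fst (split_pair (s a))) @ s b)"
    using 4(1)[symmetric] assms by (auto simp: fun_eq_iff)
  ultimately show ?case by (intro exI[of _ 3] conjI, linarith, simp only:)
qed

definition push_pair :: "nat \<Rightarrow> nat \<Rightarrow> com" where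
  "push_pair a b = Seq (Push b False) (While a (Seq (move_bit a b) (Push b True)))"

lemma exec_push_pair:
  assumes "a \<noteq> b"
  shows "exec R (push_pair a b) s (5 * length (s a) + 2) [] (s(a := [], b := pair (rev (s a)) (s b)))"
proof -
  have loop: "exec R (While a (Seq (move_bit a b) (Push b True))) s (5 * length (s a) + 1) []
      (s(a := [], b := concat (map (\<lambda>b. [True, b]) (rev (s a))) @ s b))" for s
  proof (induction "s a" arbitrary: s)
    case Nil
    then show ?case by (auto simp: fun_eq_iff)
  next
    case (Cons x xs)
    let ?s1 = "s(a := xs, b := x # s b)"
    let ?s2 = "s(a := xs, b := True # x # s b)"
    have 1: "exec R (move_bit a b) s 3 [] ?s1" using Cons assms by (intro exec_move_bit) auto
    have "exec R (Push b True) ?s1 1 [] ?s2" by simp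
    from exec.Seq[OF 1 this] have 2: "exec R (Seq (move_bit a b) (Push b True)) s 4 [] ?s2"
      by (simp del: exec_Seq_iff)
    have eq: "?s2(a := [], b := concat (map (\<lambda>b. [True, b]) (rev (?s2 a))) @ ?s2 b) =
        s(a := [], b := concat (map (\<lambda>b. [True, b]) (rev (s a))) @ s b)"
      using Cons(2)[symmetric] assms by (auto simp: fun_eq_iff)
    from exec.While_step[OF _ 2 Cons(1)[of ?s2, unfolded eq]] Cons(2)[symmetric] assms
    show ?case by simp
  qed
  have "exec R (Push b False) s 1 [] (s(b := False # s b))" by simp
  from exec.Seq[OF this loop[of "s(b := False # s b)"]] assms
  show ?thesis unfolding push_pair_def by (simp add: pair_def fun_upd_twist del: exec_Seq_iff)
qed

section \<open>Clocked programs\<close>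

text \<open>A loop tests one register only, so the two conditions, ticks left and a nonempty loop
  register, are combined into the flag. One tick pays for the test.\<close>

definition clock_test :: "nat \<Rightarrow> com" where
  "clock_test r = Seq (Pop 0) (Branch 0
     (Branch (r + 2) (Push 1 True) (Push 1 True) Skip)
     (Branch (r + 2) (Push 1 True) (Push 1 True) Skip) Skip)"

text \<open>Register 0 is the clock, register 1 a flag that controls all loops (it is empty whenever a loop body
  starts, so nested loops can share it), and register \<open>r\<close> of the program becomes \<open>r + 2\<close>. An empty clock
  makes every loop stop.\<close>
primrec clocked :: "com \<Rightarrow> com" where
  "clocked Skip = Pop 0"
| "clocked (Push r b) = Seq (Pop 0) (Push (r + 2) b)"
| "clocked (Pop r) = Seq (Pop 0) (Pop (r + 2))"
| "clocked (Seq c1 c2) = Seq (clocked c1) (clocked c2)"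
| "clocked (Branch r c1 c2 c3) =
     Seq (Pop 0) (Branch (r + 2) (clocked c1) (clocked c2) (clocked c3))"
| "clocked (While r c) =
     Seq (clock_test r) (While 1 (Seq (Pop 1) (Seq (clocked c) (clock_test r))))"
| "clocked (Query y p a) = clear 0"

abbreviation regs_from :: "nat \<Rightarrow> store \<Rightarrow> store" where
  "regs_from k s \<equiv> \<lambda>r. s (r + k)"

text \<open>The contract of the simulation: whether ticks remain decides if the program has a
  query-free run in fewer than \<open>length (s 0)\<close> steps. For an empty clock a lower bound
  on the time, instead of divergence, is what composes.\<close>

definition clock_ok :: "com \<Rightarrow> store \<Rightarrow> store \<Rightarrow> bool" where
  "clock_ok c s s' \<longleftrightarrow> length (s' 0) \<le> length (s 0) \<and> s' 1 = [] \<and>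
     (s' 0 \<noteq> [] \<longrightarrow> (\<exists>t. exec {} c (regs_from 2 s) t [] (regs_from 2 s') \<and>
        length (s 0) = length (s' 0) + t)) \<and>
     (s' 0 = [] \<longrightarrow> (\<forall>t u. exec {} c (regs_from 2 s) t [] u \<longrightarrow> length (s 0) \<le> t))"

lemma clock_ok_length: "clock_ok c s s' \<Longrightarrow> length (s' 0) \<le> length (s 0)"
  and clock_ok_Nil: "clock_ok c s s' \<Longrightarrow> s' 1 = []"
  by (simp_all only: clock_ok_def)

lemma length_le1_if_tl: "tl xs = [] \<Longrightarrow> length xs \<le> Suc 0"
  by (cases xs) auto

lemma length_gt1_if_tl: "tl xs \<noteq> [] \<Longrightarrow> Suc 0 < length xs"
  by (cases xs) auto

lemma clock_ok_Seq:
  assumes "clock_ok c1 s s1" "clock_ok c2 s1 s2"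
  shows "clock_ok (Seq c1 c2) s s2"
proof -
  have "length (s2 0) \<le> length (s 0)" "s2 1 = []"
    using assms by (auto simp: clock_ok_def)
  moreover have "\<exists>t. exec {} (Seq c1 c2) (regs_from 2 s) t [] (regs_from 2 s2) \<and>
      length (s 0) = length (s2 0) + t" if "s2 0 \<noteq> []"
  proof -
    from that assms(2) have "s1 0 \<noteq> []" by (auto simp: clock_ok_def)
    with assms(1) obtain t1 where 1: "exec {} c1 (regs_from 2 s) t1 [] (regs_from 2 s1)"
      "length (s 0) = length (s1 0) + t1" by (auto simp: clock_ok_def)
    from that assms(2) obtain t2 where 2: "exec {} c2 (regs_from 2 s1) t2 [] (regs_from 2 s2)"
      "length (s1 0) = length (s2 0) + t2" by (auto simp: clock_ok_def)
    from exec.Seq[OF 1(1) 2(1)] 1 2 show ?thesis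
      by (intro exI[of _ "t1 + t2"]) (simp del: exec_Seq_iff)
  qed
  moreover have "length (s 0) \<le> t" if "s2 0 = []" "exec {} (Seq c1 c2) (regs_from 2 s) t [] u" for t u
  proof -
    \<comment> \<open>Either the clock expired during \<open>c1\<close>, or determinism identifies
      this run of \<open>c1\<close> with the simulated one and the remaining ticks are charged to
      \<open>c2\<close>.\<close>
    from that(2) obtain t1 u1 t2 where u: "exec {} c1 (regs_from 2 s) t1 [] u1"
      "exec {} c2 u1 t2 [] u" "t = t1 + t2" by auto
    show ?thesis
    proof (cases "s1 0 = []")
      case True
      with assms(1) u(1) have "length (s 0) \<le> t1" by (auto simp: clock_ok_def)
      with u(3) show ?thesis by simp
    next
      case False
      with assms(1) obtain t1' where 1: "exec {} c1 (regs_from 2 s) t1' [] (regs_from 2 s1)"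
        "length (s 0) = length (s1 0) + t1'" by (auto simp: clock_ok_def)
      with exec_deterministic[OF 1(1) u(1)] u(2) assms(2) that(1)
      have "length (s1 0) \<le> t2" "t1 = t1'" by (auto simp: clock_ok_def)
      with 1(2) u(3) show ?thesis by simp
    qed
  qed
  ultimately show ?thesis by (auto simp: clock_ok_def simp del: exec_Seq_iff)
qed

lemma exec_clock_test:
  assumes "s 1 = []"
  shows "\<exists>t \<le> 4. exec {} (clock_test r) s t []
    (s(0 := tl (s 0), 1 := if tl (s 0) \<noteq> [] \<and> s (r + 2) \<noteq> [] then [True] else []))"
proof -
  have [simp]: "s(0 := tl (s 0), Suc 0 := []) = s(0 := tl (s 0))"
    using assms by (auto simp: fun_eq_iff)
  show ?thesis
    by (cases "tl (s 0)"; cases "s (Suc (Suc r))")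
      (use assms in \<open>auto simp: clock_test_def intro: exI[of _ 3] exI[of _ 4]\<close>)
qed

text \<open>
  The body of the loop in \<open>clocked (While r c)\<close> starts with a nonempty clock, so every iteration
  uses up at least one tick; this makes the running time linear in the clock.
\<close>
lemma exec_clocked_While:
  assumes c: "\<And>s. s 1 = [] \<Longrightarrow> \<exists>t s'. exec {} (clocked c) s t [] s' \<and> clock_ok c s s' \<and>
    t \<le> K * (length (s 0) - length (s' 0) + 1)"
    and "s 1 = []"
  shows "\<exists>t s'. exec {} (clocked (While r c)) s t [] s' \<and> clock_ok (While r c) s s' \<and>
    t \<le> (K + 6) * (length (s 0) - length (s' 0) + 1)"
  using assms(2)
proof (induction "length (s 0)" arbitrary: s rule: less_induct)
  case less
  let ?body = "Seq (Pop 1) (Seq (clocked c) (clock_test r))"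
  show ?case
  proof (cases "tl (s 0) \<noteq> [] \<and> s (r + 2) \<noteq> []")
    case False
    let ?s1 = "s(0 := tl (s 0))"
    have eq: "s(0 := tl (s 0), 1 := if tl (s 0) \<noteq> [] \<and> s (r + 2) \<noteq> [] then [True] else []) = ?s1"
      using less.prems False by (auto simp: fun_eq_iff)
    obtain t where t: "t \<le> 4" "exec {} (clock_test r) s t [] ?s1"
      using exec_clock_test[where s = s and r = r, OF less.prems] unfolding eq by blast
    have "exec {} (While 1 ?body) ?s1 1 [] ?s1" using less.prems by simp
    from exec.Seq[OF t(2) this] have "exec {} (clocked (While r c)) s (t + 1) [] ?s1"
      by (simp del: exec_Seq_iff)
    moreover have "clock_ok (While r c) s ?s1"
    proof (cases "tl (s 0) = []")
      case True
      \<comment> \<open>At most one tick was left, and every run takes positive time.\<close>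
      then have "length (s 0) \<le> t" if "t > 0" for t using length_le1_if_tl[OF True] that by simp
      then show ?thesis
        using True less.prems unfolding clock_ok_def by (auto dest: exec_time_pos)
    next
      case tl: False
      have "regs_from 2 ?s1 = regs_from 2 s" by auto
      then have "exec {} (While r c) (regs_from 2 s) 1 [] (regs_from 2 ?s1)"
        using False tl by simp
      then show ?thesis
        using tl less.prems length_gt1_if_tl[OF tl] unfolding clock_ok_def by auto
    qed
    moreover have "t + 1 \<le> (K + 6) * (length (s 0) - length (?s1 0) + 1)"
      using t(1) by (simp add: algebra_simps)
    ultimately show ?thesis by blast
  next
    case True
    let ?s1 = "s(0 := tl (s 0), 1 := [True])" and ?s2 = "s(0 := tl (s 0))"
    have eq: "s(0 := tl (s 0), 1 := if tl (s 0) \<noteq> [] \<and> s (r + 2) \<noteq> [] then [True] else []) = ?s1"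
      using True by simp
    obtain t where t: "t \<le> 4" "exec {} (clock_test r) s t [] ?s1"
      using exec_clock_test[where s = s and r = r, OF less.prems] unfolding eq by blast
    have pop: "exec {} (Pop 1) ?s1 1 [] ?s2" using less.prems by (auto simp: fun_eq_iff)
    obtain t3 s3 where 3: "exec {} (clocked c) ?s2 t3 [] s3" "clock_ok c ?s2 s3"
      "t3 \<le> K * (length (?s2 0) - length (s3 0) + 1)"
      using c[of ?s2] less.prems by auto
    obtain n where len: "length (s 0) = Suc n" "length (tl (s 0)) = n"
      using True by (cases "s 0") auto
    have len3: "length (s3 0) \<le> n" "s3 1 = []"
      using clock_ok_length[OF 3(2)] clock_ok_Nil[OF 3(2)] len by simp_all
    have "length (s3 0) < length (s 0)" using len3(1) len by simp
    from less.hyps[OF this len3(2)] obtain t4 s4 where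
      4: "exec {} (clocked (While r c)) s3 t4 [] s4"
      "clock_ok (While r c) s3 s4"
      "t4 \<le> (K + 6) * (length (s3 0) - length (s4 0) + 1)"
      by (elim exE conjE) (rule that)
    from 4(1)[unfolded clocked.simps exec_Seq_iff] obtain t5 q5 s5 t6 q6
      where "exec {} (clock_test r) s3 t5 q5 s5" "exec {} (While 1 ?body) s5 t6 q6 s4"
        "t4 = t5 + t6" "[] = q5 @ q6" by blast
    then have 5: "exec {} (clock_test r) s3 t5 [] s5" "exec {} (While 1 ?body) s5 t6 [] s4"
      "t4 = t5 + t6" by simp_all
    from exec.Seq[OF pop exec.Seq[OF 3(1) 5(1)]]
    have "exec {} ?body ?s1 (1 + (t3 + t5)) [] s5" by (simp del: exec_Seq_iff)
    from exec.While_step[OF _ this 5(2)]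
    have "exec {} (While 1 ?body) ?s1 (Suc (1 + (t3 + t5) + t6)) [] s4" by simp
    from exec.Seq[OF t(2) this]
    have "exec {} (clocked (While r c)) s (t + Suc (1 + (t3 + t5) + t6)) [] s4"
      by (simp del: exec_Seq_iff)
    moreover have "t + Suc (1 + (t3 + t5) + t6) \<le> (K + 6) * (length (s 0) - length (s4 0) + 1)"
    proof -
      have "length (s4 0) \<le> length (s3 0)" using 4(2) by (rule clock_ok_length)
      \<comment> \<open>The tick spent by \<open>clock_test\<close> supplies the second summand 1,
        so the bounds of the body and of the remaining loop add up exactly.\<close>
      then have d: "length (s 0) - length (s4 0) + 1 =
          (length (?s2 0) - length (s3 0) + 1) + (length (s3 0) - length (s4 0) + 1)"
        using len len3 by simp
      have "t + Suc (1 + (t3 + t5) + t6) \<le> 6 + t3 + t4" using t(1) 5(3) by simp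
      also have "\<dots> \<le> 6 * (length (?s2 0) - length (s3 0) + 1) +
          K * (length (?s2 0) - length (s3 0) + 1) + (K + 6) * (length (s3 0) - length (s4 0) + 1)"
        using 3(3) 4(3) by simp
      finally show ?thesis unfolding d by (simp only: distrib_left distrib_right ac_simps)
    qed
    moreover have "clock_ok (While r c) s s4"
    proof -
      \<comment> \<open>A loop on a nonempty register runs like its body followed by itself, one
        step later; the tick removed by the test accounts for this step.\<close>
      have ok: "clock_ok (Seq c (While r c)) ?s2 s4" using clock_ok_Seq 3(2) 4(2) by blast
      have ex: "exec {} (While r c) (regs_from 2 s) t [] u \<longleftrightarrow>
          (\<exists>t'. t = Suc t' \<and> exec {} (Seq c (While r c)) (regs_from 2 ?s2) t' [] u)" for t u
        using True by (auto simp: exec_While_Cons)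
      have len2: "length (?s2 0) = n" using len(2) by simp
      show ?thesis using ok unfolding clock_ok_def ex len(1) len2
        by (cases "s4 0 = []") (auto simp del: exec_Seq_iff)
    qed
    ultimately show ?thesis by blast
  qed
qed

text \<open>Time is charged to the ticks used rather than to the whole clock, so that nested loops
  stay linear. The \<open>+ 1\<close> pays for what is still executed once the clock is
  empty.\<close>

lemma exec_clocked:
  "\<exists>K. \<forall>s. s 1 = [] \<longrightarrow> (\<exists>t s'. exec {} (clocked c) s t [] s' \<and> clock_ok c s s' \<and>
     t \<le> K * (length (s 0) - length (s' 0) + 1))"
proof (induction c)
  case Skip
  show ?case
    by (rule exI[of _ 1]) (auto simp: clock_ok_def dest!: length_le1_if_tl length_gt1_if_tl)
next
  case (Push r b)
  have [simp]: "(\<lambda>x. if x = r then b # s (Suc (Suc r)) else s (Suc (Suc x))) =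
    (regs_from 2 s)(r := b # s (Suc (Suc r)))" for s :: store by auto
  show ?case
    by (rule exI[of _ 2], simp add: clock_ok_def)
      (auto simp: fun_eq_iff dest!: length_le1_if_tl length_gt1_if_tl)
next
  case (Pop r)
  show ?case
    by (rule exI[of _ 2], simp add: clock_ok_def)
      (auto simp: fun_eq_iff dest!: length_le1_if_tl length_gt1_if_tl)
next
  case (Seq c1 c2)
  obtain K1 where K1: "\<And>s. s 1 = [] \<Longrightarrow> \<exists>t s'. exec {} (clocked c1) s t [] s' \<and> clock_ok c1 s s' \<and>
     t \<le> K1 * (length (s 0) - length (s' 0) + 1)" using Seq(1) by blast
  obtain K2 where K2: "\<And>s. s 1 = [] \<Longrightarrow> \<exists>t s'. exec {} (clocked c2) s t [] s' \<and> clock_ok c2 s s' \<and>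
     t \<le> K2 * (length (s 0) - length (s' 0) + 1)" using Seq(2) by blast
  show ?case
  proof (rule exI[of _ "K1 + K2"], intro allI impI)
    fix s :: store assume "s 1 = []"
    from K1[where s = s, OF this] obtain t1 s1 where 1: "exec {} (clocked c1) s t1 [] s1" "clock_ok c1 s s1"
      "t1 \<le> K1 * (length (s 0) - length (s1 0) + 1)" by blast
    then have le1: "length (s1 0) \<le> length (s 0)" "s1 1 = []"
      by (blast intro: clock_ok_length clock_ok_Nil)+
    from K2[where s = s1, OF this(2)] obtain t2 s2 where 2: "exec {} (clocked c2) s1 t2 [] s2" "clock_ok c2 s1 s2"
      "t2 \<le> K2 * (length (s1 0) - length (s2 0) + 1)" by blast
    then have le2: "length (s2 0) \<le> length (s1 0)" by (blast intro: clock_ok_length)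
    have "t1 \<le> K1 * (length (s 0) - length (s2 0) + 1)"
      by (rule order_trans[OF 1(3)]) (use le2 in \<open>simp add: mult_le_mono2 diff_le_mono2\<close>)
    moreover have "t2 \<le> K2 * (length (s 0) - length (s2 0) + 1)"
      by (rule order_trans[OF 2(3)]) (use le1 in \<open>simp add: mult_le_mono2 diff_le_mono\<close>)
    ultimately have "t1 + t2 \<le> (K1 + K2) * (length (s 0) - length (s2 0) + 1)"
      by (simp only: distrib_right add_mono)
    moreover from exec.Seq[OF 1(1) 2(1)]
    have "exec {} (clocked (Seq c1 c2)) s (t1 + t2) [] s2" by (simp del: exec_Seq_iff)
    ultimately show "\<exists>t s'. exec {} (clocked (Seq c1 c2)) s t [] s' \<and> clock_ok (Seq c1 c2) s s' \<and>
        t \<le> (K1 + K2) * (length (s 0) - length (s' 0) + 1)"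
      using clock_ok_Seq[OF 1(2) 2(2)] by blast
  qed
next
  case (Branch r c1 c2 c3)
  obtain K1 where K1: "\<And>s. s 1 = [] \<Longrightarrow> \<exists>t s'. exec {} (clocked c1) s t [] s' \<and> clock_ok c1 s s' \<and>
     t \<le> K1 * (length (s 0) - length (s' 0) + 1)" using Branch(1) by blast
  obtain K2 where K2: "\<And>s. s 1 = [] \<Longrightarrow> \<exists>t s'. exec {} (clocked c2) s t [] s' \<and> clock_ok c2 s s' \<and>
     t \<le> K2 * (length (s 0) - length (s' 0) + 1)" using Branch(2) by blast
  obtain K3 where K3: "\<And>s. s 1 = [] \<Longrightarrow> \<exists>t s'. exec {} (clocked c3) s t [] s' \<and> clock_ok c3 s s' \<and>
     t \<le> K3 * (length (s 0) - length (s' 0) + 1)" using Branch(3) by blast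
  show ?case
  proof (rule exI[of _ "K1 + K2 + K3 + 2"], intro allI impI)
    fix s :: store assume s: "s 1 = []"
    let ?s1 = "s(0 := tl (s 0))"
    define c where "c = (case s (r + 2) of [] \<Rightarrow> c3 | b # _ \<Rightarrow> if b then c1 else c2)"
    define K where "K = (case s (r + 2) of [] \<Rightarrow> K3 | b # _ \<Rightarrow> if b then K1 else K2)"
    have "\<exists>t s'. exec {} (clocked c) ?s1 t [] s' \<and> clock_ok c ?s1 s' \<and>
      t \<le> K * (length (?s1 0) - length (s' 0) + 1)"
    proof (cases "s (r + 2)")
      case Nil
      then show ?thesis using K3[of ?s1] s by (simp add: c_def K_def)
    next
      case (Cons b v)
      then show ?thesis using K1[of ?s1] K2[of ?s1] s by (cases b) (simp_all add: c_def K_def)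
    qed
    then obtain t s' where 1: "exec {} (clocked c) ?s1 t [] s'" "clock_ok c ?s1 s'"
      "t \<le> K * (length (?s1 0) - length (s' 0) + 1)" by blast
    have cl: "clocked c =
        (case ?s1 (r + 2) of [] \<Rightarrow> clocked c3 | b # _ \<Rightarrow> if b then clocked c1 else clocked c2)"
      unfolding c_def by (auto split: list.split)
    have "exec {} (Pop 0) s 1 [] ?s1" by simp
    from exec.Seq[OF this exec.Branch[OF 1(1)[unfolded cl]]]
    have "exec {} (clocked (Branch r c1 c2 c3)) s (t + 2) [] s'" by (simp del: exec_Seq_iff)
    moreover have "t + 2 \<le> (K1 + K2 + K3 + 2) * (length (s 0) - length (s' 0) + 1)"
    proof -
      have "t + 2 \<le> (K + 2) * (length (?s1 0) - length (s' 0) + 1)" using 1(3) by simp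
      also have "\<dots> \<le> (K1 + K2 + K3 + 2) * (length (s 0) - length (s' 0) + 1)"
        by (intro mult_le_mono) (auto simp: K_def split: list.split)
      finally show ?thesis .
    qed
    moreover have "clock_ok (Branch r c1 c2 c3) s s'"
    proof -
      have ex: "exec {} (Branch r c1 c2 c3) (regs_from 2 s) t [] u \<longleftrightarrow>
          (\<exists>t'. t = Suc t' \<and> exec {} c (regs_from 2 ?s1) t' [] u)" for t u
        by (simp add: c_def)
      show ?thesis
      proof (cases "s' 0 = []")
        case True
        then have "length (tl (s 0)) \<le> t" if "exec {} c (regs_from 2 ?s1) t [] u" for t u
          using 1(2) that by (auto simp: clock_ok_def)
        then show ?thesis using 1(2) True unfolding clock_ok_def ex by fastforce
      next
        case False
        then have "tl (s 0) \<noteq> []" using clock_ok_length[OF 1(2)] by (auto simp del: length_tl)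
        from length_gt1_if_tl[OF this] show ?thesis
          using 1(2) False unfolding clock_ok_def ex by auto
      qed
    qed
    ultimately show "\<exists>t s'. exec {} (clocked (Branch r c1 c2 c3)) s t [] s' \<and>
        clock_ok (Branch r c1 c2 c3) s s' \<and>
        t \<le> (K1 + K2 + K3 + 2) * (length (s 0) - length (s' 0) + 1)" by blast
  qed
next
  case (While r c)
  then obtain K where K: "\<And>s. s 1 = [] \<Longrightarrow> \<exists>t s'. exec {} (clocked c) s t [] s' \<and> clock_ok c s s' \<and>
    t \<le> K * (length (s 0) - length (s' 0) + 1)" by blast
  show ?case using exec_clocked_While[OF K] by blast
next
  case (Query y p a)
  show ?case
  proof (rule exI[of _ 2], intro allI impI)
    fix s :: store assume "s 1 = []"
    \<comment> \<open>A query has no query-free run, so with an emptied clock the lower bound holds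
      vacuously.\<close>
    then have "clock_ok (Query y p a) s (s(0 := []))" by (auto simp: clock_ok_def)
    moreover have "2 * length (s 0) + 1 \<le> 2 * (length (s 0) - length ((s(0 := [])) 0) + 1)" by simp
    ultimately show "\<exists>t s'. exec {} (clocked (Query y p a)) s t [] s' \<and>
        clock_ok (Query y p a) s s' \<and> t \<le> 2 * (length (s 0) - length (s' 0) + 1)"
      using exec_clear[of "{}" 0 s] unfolding clocked.simps by blast
  qed
qed

section \<open>Certificates that make a program halt\<close>

text \<open>The choice of registers anticipates the shift by 3 in \<open>lookup\<close>: instance
  and guess become registers 0 and 3 of the simulated program.\<close>

definition machine_input :: "bitstring \<Rightarrow> bitstring \<Rightarrow> bitstring \<Rightarrow> store" where
  "machine_input a x w = (\<lambda>_. [])(0 := a, 3 := x, 6 := w)"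

text \<open>With the clock \<open>k\<close> in the input, the language is decidable in polynomial
  time even if \<open>c\<close> may diverge. The inequality is strict because a successful
  simulation leaves the clock nonempty.\<close>

definition accepted :: "com \<Rightarrow> problem" where
  "accepted c = {v. let (z, u) = split_pair v; (x, a) = split_pair z; (w, k) = split_pair u
     in \<exists>t s'. t < length k \<and> runs c (machine_input a x w) t s'}"

text \<open>After unpacking, register 0 is the clock, and 2, 5, 8 are the registers 0, 3, 6 of
  \<open>c\<close> in the numbering of \<open>clocked\<close>.\<close>

definition verifier :: "com \<Rightarrow> com" where
  "verifier c = Seq (unpair 3 0 1) (Seq (move 1 2) (Seq (unpair 3 2 1) (Seq (move 1 5)
     (Seq (unpair 3 0 1) (Seq (move 1 8) (Seq (clocked c)
       (Branch 0 (Seq (clear 0) (Push 0 True)) (Seq (clear 0) (Push 0 True)) (Push 0 False))))))))"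

lemma accepted_in_P: "accepted c \<in> class_P"
proof -
  obtain K where K: "\<And>s. s 1 = [] \<Longrightarrow> \<exists>t s'. exec {} (clocked c) s t [] s' \<and> clock_ok c s s' \<and>
     t \<le> K * (length (s 0) - length (s' 0) + 1)"
    using exec_clocked by blast
  have "\<exists>t s'. runs (verifier c) (load [v]) t s' \<and> t \<le> poly [:K + 100, K + 100:] (length v) \<and>
      s' 0 = [v \<in> accepted c]" for v
  proof -
    obtain z u where v: "split_pair v = (z, u)" by fastforce
    obtain x a where z: "split_pair z = (x, a)" by fastforce
    obtain w k where u: "split_pair u = (w, k)" by fastforce
    have len: "2 * length z + length u \<le> length v" "2 * length x + length a \<le> length z"
      "2 * length w + length k \<le> length u"
      using length_split_pair[of v] length_split_pair[of z] length_split_pair[of u] v z u by simp_all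
    define s0 :: store where "s0 = (\<lambda>_. [])(0 := v)"
    define s1 where "s1 = s0(0 := u, 1 := rev z)"
    define s2 where "s2 = s1(1 := [], 2 := z)"
    define s3 where "s3 = s2(2 := a, 1 := rev x)"
    define s4 where "s4 = s3(1 := [], 5 := x)"
    define s5 where "s5 = s4(0 := k, 1 := rev w)"
    define s6 where "s6 = s5(1 := [], 8 := w)"
    note ss = s0_def s1_def s2_def s3_def s4_def s5_def s6_def
    have s0: "load [v] = s0" by (auto simp: load_def s0_def)
    obtain t1 where 1: "t1 \<le> 8 * length v + 3" "exec {} (unpair 3 0 1) s0 t1 [] s1"
      using exec_unpair[of s0 3 0 1 "{}"] v by (auto simp: s0_def s1_def)
    have 2: "exec {} (move 1 2) s1 (4 * length z + 1) [] s2"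
      using exec_move[of 1 2 "{}" s1] by (simp add: ss)
    obtain t3 where 3: "t3 \<le> 8 * length z + 3" "exec {} (unpair 3 2 1) s2 t3 [] s3"
      using exec_unpair[of s2 3 2 1 "{}"] z by (auto simp: ss)
    have 4: "exec {} (move 1 5) s3 (4 * length x + 1) [] s4"
      using exec_move[of 1 5 "{}" s3] by (simp add: ss)
    obtain t5 where 5: "t5 \<le> 8 * length u + 3" "exec {} (unpair 3 0 1) s4 t5 [] s5"
      using exec_unpair[of s4 3 0 1 "{}"] u by (auto simp: ss)
    have 6: "exec {} (move 1 8) s5 (4 * length w + 1) [] s6"
      using exec_move[of 1 8 "{}" s5] by (simp add: ss)
    have s6: "s6 0 = k" "s6 1 = []" "regs_from 2 s6 = machine_input a x w"
      by (auto simp: ss machine_input_def)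
    obtain t7 s7 where 7: "exec {} (clocked c) s6 t7 [] s7" "clock_ok c s6 s7"
      "t7 \<le> K * (length (s6 0) - length (s7 0) + 1)"
      using K[of s6] s6 by auto
    have acc: "v \<in> accepted c \<longleftrightarrow> s7 0 \<noteq> []"
    proof (cases "s7 0 = []")
      case True
      then show ?thesis using 7(2)[unfolded clock_ok_def s6] v z u
        by (fastforce simp: accepted_def runs_def)
    next
      case False
      with 7(2)[unfolded clock_ok_def s6] obtain t
        where "exec {} c (machine_input a x w) t [] (regs_from 2 s7)" "length k = length (s7 0) + t"
        by blast
      with False have "\<exists>t s'. t < length k \<and> runs c (machine_input a x w) t s'"
        unfolding runs_def by (intro exI[of _ t]) auto
      with False show ?thesis using v z u by (simp add: accepted_def)
    qed
    have len7: "length (s7 0) \<le> length k" using clock_ok_length[OF 7(2)] s6 by simp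
    define s8 where "s8 = s7(0 := [s7 0 \<noteq> []])"
    have "\<exists>t8 \<le> 2 * length k + 4. exec {} (Branch 0 (Seq (clear 0) (Push 0 True))
        (Seq (clear 0) (Push 0 True)) (Push 0 False)) s7 t8 [] s8"
    proof (cases "s7 0")
      case Nil
      then show ?thesis by (auto simp: s8_def)
    next
      case (Cons b ys)
      have "exec {} (Push 0 True) (s7(0 := [])) 1 [] s8" by (simp add: s8_def Cons)
      from exec.Seq[OF exec_clear this]
      have "exec {} (Seq (clear 0) (Push 0 True)) s7 (2 * length (s7 0) + 2) [] s8"
        by (simp del: exec_Seq_iff)
      with Cons have "exec {} (Branch 0 (Seq (clear 0) (Push 0 True))
        (Seq (clear 0) (Push 0 True)) (Push 0 False)) s7 (Suc (2 * length (s7 0) + 2)) [] s8"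
        by (intro exec.Branch) (simp del: exec_Seq_iff)
      with len7 show ?thesis by (intro exI[of _ "Suc (2 * length (s7 0) + 2)"]) linarith
    qed
    then obtain t8 where 8: "t8 \<le> 2 * length k + 4" "exec {} (Branch 0 (Seq (clear 0) (Push 0 True))
        (Seq (clear 0) (Push 0 True)) (Push 0 False)) s7 t8 [] s8" by blast
    from exec.Seq[OF 1(2) exec.Seq[OF 2 exec.Seq[OF 3(2) exec.Seq[OF 4 exec.Seq[OF 5(2)
      exec.Seq[OF 6 exec.Seq[OF 7(1) 8(2)]]]]]]]
    have "runs (verifier c) (load [v]) (t1 + (4 * length z + 1 + (t3 + (4 * length x + 1 +
      (t5 + (4 * length w + 1 + (t7 + t8))))))) s8"
      unfolding s0 by (simp add: runs_def verifier_def del: exec_Seq_iff exec_Branch_iff)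
    moreover have "t1 + (4 * length z + 1 + (t3 + (4 * length x + 1 +
      (t5 + (4 * length w + 1 + (t7 + t8)))))) \<le> poly [:K + 100, K + 100:] (length v)"
    proof -
      have "length (s6 0) - length (s7 0) + 1 \<le> length v + 1" using len s6(1) by simp
      from order_trans[OF 7(3) mult_le_mono2[OF this]] have "t7 \<le> K * (length v + 1)" .
      then show ?thesis using 1(1) 3(1) 5(1) 8(1) len by (simp add: algebra_simps)
    qed
    moreover have "s8 0 = [v \<in> accepted c]" by (simp add: s8_def acc)
    ultimately show ?thesis by blast
  qed
  then have "polytime_computable (\<lambda>v. [v \<in> accepted c])"
    unfolding polytime_computable_def by blast
  then show ?thesis by (simp add: class_P_def)
qed

lemma poly_nat_mono: "x \<le> y \<Longrightarrow> poly (p :: nat poly) x \<le> poly p y"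
  by (induction p) (auto intro: add_mono mult_mono)

lemma length_pair [simp]: "length (pair x y) = 2 * length x + 1 + length y"
  by (induction x) (auto simp: pair_def)

text \<open>The second component of a witness is the clock.\<close>
lemma coNP_poly_advice_I:
  assumes advice: "\<And>n. length (a n) \<le> poly q n"
    and sound: "\<And>x w t s'. x \<in> A \<Longrightarrow> \<not> runs c (machine_input (a (length x)) x w) t s'"
    and complete: "\<And>x. x \<notin> A \<Longrightarrow> \<exists>w t s'. length w \<le> poly q (length x) \<and>
      t \<le> poly q (length x) \<and> runs c (machine_input (a (length x)) x w) t s'"
  shows "A \<in> with_poly_advice class_coNP"
proof -
  \<comment> \<open>A pair takes twice its first component, here \<open>w\<close>, plus 1; the clock
    adds \<open>t + 1\<close>.\<close>
  define q' where "q' = 3 * q + 2"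
  \<comment> \<open>The program certifies \<open>x \<notin> A\<close>, so \<open>B\<close> is the
    side in NP and its complement decides \<open>A\<close> with advice.\<close>
  define B where "B = {z. \<exists>u. length u \<le> poly q' (length z) \<and> pair z u \<in> accepted c}"
  have "B \<in> class_NP"
    unfolding class_NP_def B_def using accepted_in_P by blast
  then have coNP: "- B \<in> class_coNP" by (simp add: class_coNP_def)
  have "x \<in> A \<longleftrightarrow> pair x (a (length x)) \<in> - B" for x
  proof (cases "x \<in> A")
    case True
    then show ?thesis using sound[OF True]
      by (auto simp: B_def accepted_def split: prod.splits)
  next
    case False
    then obtain w t s' where w: "length w \<le> poly q (length x)" "t \<le> poly q (length x)"
      "runs c (machine_input (a (length x)) x w) t s'" using complete by blast
    define k where "k = replicate (t + 1) True"
    have "pair (pair x (a (length x))) (pair w k) \<in> accepted c"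
      using w(3) by (auto simp: accepted_def k_def)
    moreover have "length (pair w k) \<le> poly q' (length (pair x (a (length x))))"
    proof -
      have "length (pair w k) \<le> poly q' (length x)"
        using w by (simp add: q'_def k_def)
      also have "\<dots> \<le> poly q' (length (pair x (a (length x))))"
        by (rule poly_nat_mono) simp
      finally show ?thesis .
    qed
    ultimately show ?thesis using False by (auto simp: B_def intro!: exI[of _ "pair w k"])
  qed
  with advice coNP show ?thesis unfolding with_poly_advice_def by blast
qed

section \<open>Answering queries from a transcript\<close>

lemma pair_inject [simp]: "pair x y = pair x' y' \<longleftrightarrow> x = x' \<and> y = y'"
  by (metis split_pair_pair prod.inject)

lemma unary_inject: "unary n @ False # v = unary m @ False # v' \<longleftrightarrow> n = m \<and> v = v'"
proof (induction n arbitrary: m)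
  case 0 then show ?case by (cases m) (auto simp: unary_def)
next
  case (Suc n) then show ?case by (cases m) (auto simp: unary_def)
qed

text \<open>A mismatch diverges, so a transcript that does not fit yields no run. The lemmas on
  these programs are equivalences, because soundness has to know all their runs.\<close>

definition expect :: "bool \<Rightarrow> com" where
  "expect b = (if b then Branch 0 (Pop 0) diverge diverge else Branch 0 diverge (Pop 0) diverge)"

lemma exec_expect_iff:
  "exec R (expect b) s t qs s' \<longleftrightarrow> t = 2 \<and> qs = [] \<and> (\<exists>v. s 0 = b # v \<and> s' = s(0 := v))"
  by (cases "s 0") (auto simp: expect_def)

text \<open>The compared symbols are saved, reversed, in register 1, from where
  \<open>answer_query\<close> restores \<open>y\<close>: a query leaves its arguments
  intact.\<close>

definition match_string :: "nat \<Rightarrow> com" where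
  "match_string y = Seq (While y (Seq (expect True)
     (Branch y (Seq (expect True) (move_bit y 1)) (Seq (expect False) (move_bit y 1)) Skip)))
     (expect False)"

lemma exec_match_string_iff:
  assumes "y > 1"
  shows "exec R (match_string y) s t qs s' \<longleftrightarrow> t = 9 * length (s y) + 3 \<and> qs = [] \<and>
    (\<exists>v. s 0 = pair (s y) v \<and> s' = s(0 := v, y := [], 1 := rev (s y) @ s 1))"
proof -
  define body where "body = Seq (expect True)
     (Branch y (Seq (expect True) (move_bit y 1)) (Seq (expect False) (move_bit y 1)) Skip)"
  have body: "exec R body s t qs s' \<longleftrightarrow> t = 8 \<and> qs = [] \<and>
      (\<exists>v. s 0 = True # x # v \<and> s' = s(0 := v, y := xs, 1 := x # s 1))"
    if "s y = x # xs" for s t qs s' x xs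
  proof -
    have move: "exec R (move_bit y 1) (s(0 := v)) t qs s' \<longleftrightarrow>
        t = 3 \<and> qs = [] \<and> s' = s(0 := v, y := xs, 1 := x # s 1)" for t qs s' v
      by (subst exec_iff[OF exec_move_bit[of y 1 "s(0 := v)" x xs]]) (use that assms in auto)
    show ?thesis
      using that assms by (cases x) (auto simp: body_def exec_expect_iff move[unfolded One_nat_def])
  qed
  have loop: "exec R (While y body) s t qs s' \<longleftrightarrow> t = 9 * length (s y) + 1 \<and> qs = [] \<and>
      (\<exists>v. s 0 = concat (map (\<lambda>b. [True, b]) (s y)) @ v \<and> s' = s(0 := v, y := [], 1 := rev (s y) @ s 1))"
    for s t qs s'
  proof (induction "s y" arbitrary: s t qs s')
    case Nil
    then have "s(0 := s 0, y := [], 1 := rev (s y) @ s 1) = s" by (auto simp: fun_eq_iff)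
    with Nil show ?case by auto
  next
    case (Cons x xs)
    let ?s1 = "\<lambda>v. s(0 := v, y := xs, 1 := x # s 1)"
    have IH: "exec R (While y body) (?s1 v) t qs s' \<longleftrightarrow> t = 9 * length xs + 1 \<and> qs = [] \<and>
      (\<exists>v'. v = concat (map (\<lambda>b. [True, b]) xs) @ v' \<and>
        s' = s(0 := v', y := [], 1 := rev (s y) @ s 1))" for v t qs s'
    proof -
      have eq: "(?s1 v)(0 := v', y := [], 1 := rev (?s1 v y) @ ?s1 v 1) =
          s(0 := v', y := [], 1 := rev (s y) @ s 1)" for v'
        using Cons(2)[symmetric] assms by (auto simp: fun_eq_iff)
      have "?s1 v y = xs" "?s1 v 0 = v" using assms by auto
      with Cons(1)[of "?s1 v" t qs s', unfolded eq] show ?thesis by simp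
    qed
    have "s y \<noteq> []" using Cons(2)[symmetric] by simp
    then show ?case
      unfolding exec_While_Cons[of s y, OF \<open>s y \<noteq> []\<close>]
        body[where s = s and x = x and xs = xs, OF Cons(2)[symmetric]]
      using Cons(2)[symmetric] by (auto simp: IH[unfolded One_nat_def])
  qed
  have "exec R (match_string y) s t qs s' \<longleftrightarrow> (\<exists>t1 qs1 s1 t2 qs2. t = t1 + t2 \<and> qs = qs1 @ qs2 \<and>
     exec R (While y body) s t1 qs1 s1 \<and> exec R (expect False) s1 t2 qs2 s')"
    unfolding match_string_def body_def by auto
  then show ?thesis
    unfolding loop exec_expect_iff using assms by (auto simp: pair_def fun_upd_twist)
qed

definition match_length :: "nat \<Rightarrow> com" where
  "match_length p = Seq (While p (Seq (expect True) (move_bit p 1))) (expect False)"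

lemma exec_match_length_iff:
  assumes "p > 1"
  shows "exec R (match_length p) s t qs s' \<longleftrightarrow> t = 6 * length (s p) + 3 \<and> qs = [] \<and>
    (\<exists>v. s 0 = unary (length (s p)) @ False # v \<and> s' = s(0 := v, p := [], 1 := rev (s p) @ s 1))"
proof -
  define body where "body = Seq (expect True) (move_bit p 1)"
  have body: "exec R body s t qs s' \<longleftrightarrow> t = 5 \<and> qs = [] \<and>
      (\<exists>v. s 0 = True # v \<and> s' = s(0 := v, p := xs, 1 := x # s 1))"
    if "s p = x # xs" for s t qs s' x xs
  proof -
    have move: "exec R (move_bit p 1) (s(0 := v)) t qs s' \<longleftrightarrow>
        t = 3 \<and> qs = [] \<and> s' = s(0 := v, p := xs, 1 := x # s 1)" for t qs s' v
      by (subst exec_iff[OF exec_move_bit[of p 1 "s(0 := v)" x xs]]) (use that assms in auto)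
    show ?thesis by (auto simp: body_def exec_expect_iff move[unfolded One_nat_def])
  qed
  have loop: "exec R (While p body) s t qs s' \<longleftrightarrow> t = 6 * length (s p) + 1 \<and> qs = [] \<and>
      (\<exists>v. s 0 = unary (length (s p)) @ v \<and> s' = s(0 := v, p := [], 1 := rev (s p) @ s 1))"
    for s t qs s'
  proof (induction "s p" arbitrary: s t qs s')
    case Nil
    then have "s(0 := s 0, p := [], 1 := rev (s p) @ s 1) = s" by (auto simp: fun_eq_iff)
    with Nil show ?case by (auto simp: unary_def)
  next
    case (Cons x xs)
    let ?s1 = "\<lambda>v. s(0 := v, p := xs, 1 := x # s 1)"
    have IH: "exec R (While p body) (?s1 v) t qs s' \<longleftrightarrow> t = 6 * length xs + 1 \<and> qs = [] \<and>
      (\<exists>v'. v = unary (length xs) @ v' \<and>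
        s' = s(0 := v', p := [], 1 := rev (s p) @ s 1))" for v t qs s'
    proof -
      have eq: "(?s1 v)(0 := v', p := [], 1 := rev (?s1 v p) @ ?s1 v 1) =
          s(0 := v', p := [], 1 := rev (s p) @ s 1)" for v'
        using Cons(2)[symmetric] assms by (auto simp: fun_eq_iff)
      have "?s1 v p = xs" "?s1 v 0 = v" using assms by auto
      with Cons(1)[of "?s1 v" t qs s', unfolded eq] show ?thesis by simp
    qed
    have "s p \<noteq> []" using Cons(2)[symmetric] by simp
    then show ?case
      unfolding exec_While_Cons[of s p, OF \<open>s p \<noteq> []\<close>]
        body[where s = s and x = x and xs = xs, OF Cons(2)[symmetric]]
      using Cons(2)[symmetric] by (auto simp: IH[unfolded One_nat_def] unary_def)
  qed
  have "exec R (match_length p) s t qs s' \<longleftrightarrow> (\<exists>t1 qs1 s1 t2 qs2. t = t1 + t2 \<and> qs = qs1 @ qs2 \<and>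
     exec R (While p body) s t1 qs1 s1 \<and> exec R (expect False) s1 t2 qs2 s')"
    unfolding match_length_def body_def by auto
  then show ?thesis
    unfolding loop exec_expect_iff using assms by (auto simp: fun_upd_twist)
qed

definition answer_query :: "nat \<Rightarrow> nat \<Rightarrow> nat \<Rightarrow> com" where
  "answer_query y p a = Seq (match_string y) (Seq (move 1 y) (Seq (match_length p) (Seq (move 1 p)
     (Seq (clear a) (Branch 0 (Seq (Pop 0) (Push a True)) (Seq (Pop 0) (Push a False)) diverge)))))"

text \<open>The registers \<open>y\<close>, \<open>p\<close> and \<open>a\<close> may coincide; this
  is why the arguments are restored before the answer is written.\<close>

lemma exec_answer_query_iff:
  assumes "y > 1" "p > 1" "a > 1" "s 1 = []"
  shows "exec R (answer_query y p a) s t qs s' \<longleftrightarrow>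
    t = 13 * length (s y) + 10 * length (s p) + 2 * length (s a) + 12 \<and> qs = [] \<and>
    (\<exists>b v. s 0 = pair (s y) (unary (length (s p)) @ False # b # v) \<and> s' = s(0 := v, a := [b]))"
proof -
  have restore_y: "exec R (move 1 y) (s(0 := v, y := [], 1 := rev (s y) @ s 1)) t qs s' \<longleftrightarrow>
      t = 4 * length (s y) + 1 \<and> qs = [] \<and> s' = s(0 := v)" for v t qs s'
  proof -
    have "(s(0 := v, y := [], 1 := rev (s y) @ s 1))(1 := [], y := rev (rev (s y) @ s 1) @ []) = s(0 := v)"
      using assms by (auto simp: fun_eq_iff)
    with exec_move[of 1 y R "s(0 := v, y := [], 1 := rev (s y) @ s 1)"]
    have "exec R (move 1 y) (s(0 := v, y := [], 1 := rev (s y) @ s 1)) (4 * length (s y) + 1) [] (s(0 := v))"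
      using assms by simp
    from exec_iff[OF this] show ?thesis .
  qed
  have restore_p: "exec R (move 1 p) (s(0 := v, p := [], 1 := rev (s p) @ s 1)) t qs s' \<longleftrightarrow>
      t = 4 * length (s p) + 1 \<and> qs = [] \<and> s' = s(0 := v)" for v t qs s'
  proof -
    have "(s(0 := v, p := [], 1 := rev (s p) @ s 1))(1 := [], p := rev (rev (s p) @ s 1) @ []) = s(0 := v)"
      using assms by (auto simp: fun_eq_iff)
    with exec_move[of 1 p R "s(0 := v, p := [], 1 := rev (s p) @ s 1)"]
    have "exec R (move 1 p) (s(0 := v, p := [], 1 := rev (s p) @ s 1)) (4 * length (s p) + 1) [] (s(0 := v))"
      using assms by simp
    from exec_iff[OF this] show ?thesis .
  qed
  have match_p: "exec R (match_length p) (s(0 := u)) t qs s' \<longleftrightarrow> t = 6 * length (s p) + 3 \<and> qs = [] \<and>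
    (\<exists>v. u = unary (length (s p)) @ False # v \<and> s' = s(0 := v, p := [], 1 := rev (s p) @ s 1))" for t qs s' u
    using exec_match_length_iff[OF assms(2), of R "s(0 := u)"] assms by simp
  have clear: "exec R (clear a) (s(0 := v)) t qs s' \<longleftrightarrow>
     t = 2 * length (s a) + 1 \<and> qs = [] \<and> s' = s(0 := v, a := [])" for v t qs s'
    using exec_iff[OF exec_clear[of R a "s(0 := v)"]] assms by simp
  have last: "exec R (Branch 0 (Seq (Pop 0) (Push a True)) (Seq (Pop 0) (Push a False)) diverge)
       (s(0 := u, a := [])) t qs s' \<longleftrightarrow>
     t = 3 \<and> qs = [] \<and> (\<exists>b v. u = b # v \<and> s' = s(0 := v, a := [b]))" for u t qs s'
    using assms by (cases u) (auto simp: fun_upd_twist split: if_splits)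
  show ?thesis
    by (auto simp: answer_query_def exec_match_string_iff[OF assms(1), unfolded One_nat_def]
      restore_y[unfolded One_nat_def] match_p[unfolded One_nat_def] restore_p[unfolded One_nat_def]
      clear last unary_inject simp del: exec_Branch_iff)
qed

text \<open>Register 0 holds the transcript, register 1 is scratch space; register 2 is free for
  \<open>select_item\<close>.\<close>
primrec lookup :: "com \<Rightarrow> com" where
  "lookup Skip = Skip"
| "lookup (Push r b) = Push (r + 3) b"
| "lookup (Pop r) = Pop (r + 3)"
| "lookup (Seq c1 c2) = Seq (lookup c1) (lookup c2)"
| "lookup (Branch r c1 c2 c3) = Branch (r + 3) (lookup c1) (lookup c2) (lookup c3)"
| "lookup (While r c) = While (r + 3) (lookup c)"
| "lookup (Query y p a) = answer_query (y + 3) (p + 3) (a + 3)"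

text \<open>The recorded answer is the true one for \<open>R\<close>. This makes soundness
  independent of the computation for which a transcript was recorded.\<close>

definition entry :: "param_problem \<Rightarrow> param_inst \<Rightarrow> bitstring \<Rightarrow> bitstring" where
  "entry R q v = pair (fst q) (unary (snd q) @ False # (q \<in> R) # v)"

text \<open>Only whole entries are consumed, and each has to match the query just asked, so its bit
  is what the oracle would answer. What remains is again a list of entries, which keeps the
  induction going. The transcript may stem from another input.\<close>

lemma lookup_sound:
  assumes "exec R' (lookup c) s t us s'" and "s 1 = []" and "s 0 = foldr (entry R) ps []"
  shows "\<exists>t' qs ps'. exec R c (regs_from 3 s) t' qs (regs_from 3 s') \<and> s' 1 = [] \<and>
    s' 0 = foldr (entry R) ps' []"
  using assms
proof (induction c arbitrary: s t us s' ps)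
  case Skip
  then show ?case by auto
next
  case (Push r b)
  then have "s' = s(r + 3 := b # s (r + 3))" by simp
  moreover have "regs_from 3 s' = (regs_from 3 s)(r := b # s (r + 3))"
    unfolding calculation by (auto simp: fun_eq_iff)
  ultimately show ?case using Push by auto
next
  case (Pop r)
  then have "s' = s(r + 3 := tl (s (r + 3)))" by simp
  moreover have "regs_from 3 s' = (regs_from 3 s)(r := tl (s (r + 3)))"
    unfolding calculation by (auto simp: fun_eq_iff)
  ultimately show ?case using Pop by auto
next
  case (Seq c1 c2)
  then obtain t1 us1 s1 t2 us2 where 1: "exec R' (lookup c1) s t1 us1 s1"
    and 2: "exec R' (lookup c2) s1 t2 us2 s'" by auto
  from Seq.IH(1)[OF 1 Seq.prems(2,3)] obtain t1' qs1 ps1 where 3: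
    "exec R c1 (regs_from 3 s) t1' qs1 (regs_from 3 s1)" "s1 1 = []" "s1 0 = foldr (entry R) ps1 []"
    by blast
  from Seq.IH(2)[OF 2 3(2,3)] 3(1) show ?case by (blast intro: exec.Seq)
next
  case (Branch r c1 c2 c3)
  from Branch.prems(1) obtain t1 where
    1: "exec R' (case s (r + 3) of [] \<Rightarrow> lookup c3 | b # _ \<Rightarrow> if b then lookup c1 else lookup c2) s t1 us s'"
    by auto
  have "\<exists>t' qs ps'. exec R (case s (r + 3) of [] \<Rightarrow> c3 | b # _ \<Rightarrow> if b then c1 else c2)
      (regs_from 3 s) t' qs (regs_from 3 s') \<and> s' 1 = [] \<and> s' 0 = foldr (entry R) ps' []"
  proof (cases "s (r + 3)")
    case Nil
    with 1 Branch.IH(3)[OF _ Branch.prems(2,3)] show ?thesis by simp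
  next
    case (Cons b v)
    with 1 Branch.IH(1,2)[OF _ Branch.prems(2,3)] show ?thesis by (cases b) simp_all
  qed
  then show ?case using exec.Branch[where R = R and s = "regs_from 3 s" and r = r] by blast
next
  case (While r c)
  from While.prems show ?case
  \<comment> \<open>The structural induction covers only the body of the loop; the iterations need
    an induction on the time.\<close>
  proof (induction t arbitrary: s us ps rule: less_induct)
    case (less t)
    show ?case
    proof (cases "s (r + 3) = []")
      case True
      then have "s' = s" using less.prems(1) by simp
      moreover have "exec R (While r c) (regs_from 3 s) 1 [] (regs_from 3 s)"
        using True by (intro exec.While_end)
      ultimately show ?thesis using less.prems by blast
    next
      case False
      with less.prems(1) obtain t1 us1 s1 t2 us2 where t: "t = Suc (t1 + t2)"
        and 1: "exec R' (lookup c) s t1 us1 s1"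
        and 2: "exec R' (lookup (While r c)) s1 t2 us2 s'" by (auto simp: exec_While_Cons)
      from While.IH[OF 1 less.prems(2,3)] obtain t1' qs1 ps1 where 3:
        "exec R c (regs_from 3 s) t1' qs1 (regs_from 3 s1)" "s1 1 = []" "s1 0 = foldr (entry R) ps1 []"
        by blast
      from less.IH[OF _ 2 3(2,3)] t obtain t2' qs2 ps2 where 4:
        "exec R (While r c) (regs_from 3 s1) t2' qs2 (regs_from 3 s')" "s' 1 = []"
        "s' 0 = foldr (entry R) ps2 []" by auto
      from exec.While_step[OF _ 3(1) 4(1)] False 4 show ?thesis by blast
    qed
  qed
next
  case (Query y p a)
  from Query.prems(1)[unfolded lookup.simps exec_answer_query_iff[where y = "y + 3" and p = "p + 3"
    and a = "a + 3" and s = s, OF _ _ _ Query.prems(2), simplified]]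
  obtain b v where bv: "s 0 = pair (s (y + 3)) (unary (length (s (p + 3))) @ False # b # v)"
    "s' = s(0 := v, a + 3 := [b])" by (auto simp: numeral_3_eq_3)
  with Query.prems(3) obtain q ps' where q: "ps = q # ps'" "s 0 = entry R q (foldr (entry R) ps' [])"
    by (cases ps) (auto simp: pair_def)
  \<comment> \<open>The self-delimiting code decodes uniquely, so the first entry belongs to the
    current query.\<close>
  from q(2) bv(1) have "fst q = s (y + 3)" "snd q = length (s (p + 3))" "b = (q \<in> R)"
    "v = foldr (entry R) ps' []" by (auto simp: entry_def unary_inject)
  moreover from this have "q = (s (y + 3), length (s (p + 3)))" by (simp add: prod_eq_iff)
  moreover from calculation have "regs_from 3 s' = (regs_from 3 s)(a := [(s (y + 3), length (s (p + 3))) \<in> R])"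
    unfolding bv(2) by (auto simp: fun_eq_iff)
  ultimately show ?case using bv Query.prems(2)
    by (intro exI[of _ 1] exI[of _ "[(s (y + 3), length (s (p + 3)))]"] exI[of _ ps']) auto
qed

text \<open>The suffix \<open>v\<close> lets the transcripts of consecutive parts be concatenated.
  Registers of length at most \<open>n\<close> grow to at most \<open>n + t\<close>, and a query
  costs 13 + 10 + 2 times such a length plus 12, as its arguments are compared bit by bit; 40 covers
  this.\<close>

lemma lookup_complete:
  assumes "exec R c s t qs s'" and "s = regs_from 3 u" and "u 1 = []"
    and "u 0 = foldr (entry R) qs v" and "\<And>r. length (s r) \<le> n"
  shows "\<exists>t' u'. exec {} (lookup c) u t' [] u' \<and> s' = regs_from 3 u' \<and> u' 1 = [] \<and> u' 0 = v \<and>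
    t' \<le> 40 * t * (n + t + 1)"
  using assms
proof (induction arbitrary: u v n rule: exec.induct)
  case (Skip s)
  then show ?case by auto
next
  case (Push r b s)
  have "exec {} (lookup (Push r b)) u 1 [] (u(r + 3 := b # u (r + 3)))" by simp
  with Push show ?case by (intro exI conjI) (assumption, auto simp: fun_eq_iff)
next
  case (Pop r s)
  have "exec {} (lookup (Pop r)) u 1 [] (u(r + 3 := tl (u (r + 3))))" by simp
  with Pop show ?case by (intro exI conjI) (assumption, auto simp: fun_eq_iff)
next
  case (Seq c1 s t1 qs1 s1 c2 t2 qs2 s2)
  from Seq.IH(1)[OF Seq.prems(1,2) _ Seq.prems(4), of "foldr (entry R) qs2 v"] Seq.prems(3)
  obtain t1' u1 where 1: "exec {} (lookup c1) u t1' [] u1" "s1 = regs_from 3 u1" "u1 1 = []"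
    "u1 0 = foldr (entry R) qs2 v" "t1' \<le> 40 * t1 * (n + t1 + 1)" by auto
  have "length (s1 r) \<le> n + t1" for r
    using exec_length_le[OF Seq.hyps(1), of r] Seq.prems(4)[of r] by simp
  from Seq.IH(2)[OF 1(2-4) this]
  obtain t2' u2 where 2: "exec {} (lookup c2) u1 t2' [] u2" "s2 = regs_from 3 u2" "u2 1 = []"
    "u2 0 = v" "t2' \<le> 40 * t2 * (n + t1 + t2 + 1)" by auto
  have "t1' + t2' \<le> 40 * (t1 + t2) * (n + (t1 + t2) + 1)"
    using 1(5) 2(5) by (simp add: algebra_simps)
  with exec.Seq[OF 1(1) 2(1)] 2 show ?case by (auto simp del: exec_Seq_iff)
next
  case (Branch s r c3 c1 c2 t qs s')
  from Branch.IH[OF Branch.prems] obtain t' u' where 1: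
    "exec {} (lookup (case s r of [] \<Rightarrow> c3 | b # _ \<Rightarrow> if b then c1 else c2)) u t' [] u'"
    "s' = regs_from 3 u'" "u' 1 = []" "u' 0 = v" "t' \<le> 40 * t * (n + t + 1)" by blast
  have "lookup (case s r of [] \<Rightarrow> c3 | b # _ \<Rightarrow> if b then c1 else c2) =
      (case u (r + 3) of [] \<Rightarrow> lookup c3 | b # _ \<Rightarrow> if b then lookup c1 else lookup c2)"
    using Branch.prems(1) by (auto split: list.split)
  from exec.Branch[OF 1(1)[unfolded this]]
  have "exec {} (lookup (Branch r c1 c2 c3)) u (Suc t') [] u'" by (simp del: exec_Branch_iff)
  moreover have "Suc t' \<le> 40 * Suc t * (n + Suc t + 1)" using 1(5) by (simp add: algebra_simps)
  ultimately show ?case using 1 by blast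
next
  case (While_end s r c)
  then have "exec {} (lookup (While r c)) u 1 [] u" by simp
  with While_end show ?case by (intro exI conjI) (assumption, auto)
next
  case (While_step s r c t1 qs1 s1 t2 qs2 s2)
  from While_step.IH(1)[OF While_step.prems(1,2) _ While_step.prems(4), of "foldr (entry R) qs2 v"]
    While_step.prems(3)
  obtain t1' u1 where 1: "exec {} (lookup c) u t1' [] u1" "s1 = regs_from 3 u1" "u1 1 = []"
    "u1 0 = foldr (entry R) qs2 v" "t1' \<le> 40 * t1 * (n + t1 + 1)" by auto
  have "length (s1 r) \<le> n + t1" for r
    using exec_length_le[OF While_step.hyps(2), of r] While_step.prems(4)[of r] by simp
  from While_step.IH(2)[OF 1(2-4) this]
  obtain t2' u2 where 2: "exec {} (lookup (While r c)) u1 t2' [] u2" "s2 = regs_from 3 u2" "u2 1 = []"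
    "u2 0 = v" "t2' \<le> 40 * t2 * (n + t1 + t2 + 1)" by auto
  have "u (r + 3) \<noteq> []" using While_step by auto
  with exec.While_step[OF _ 1(1) 2(1)[unfolded lookup.simps]]
  have "exec {} (lookup (While r c)) u (Suc (t1' + t2')) [] u2" by simp
  moreover have "Suc (t1' + t2') \<le> 40 * Suc (t1 + t2) * (n + Suc (t1 + t2) + 1)"
    using 1(5) 2(5) by (simp add: algebra_simps)
  ultimately show ?case using 2 by blast
next
  case (Query y p a s)
  have lens: "length (u (y + 3)) \<le> n" "length (u (p + 3)) \<le> n" "length (u (a + 3)) \<le> n"
    using Query.prems(1,4) by (metis)+
  have "exec {} (lookup (Query y p a)) u
      (13 * length (u (y + 3)) + 10 * length (u (p + 3)) + 2 * length (u (a + 3)) + 12) []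
      (u(0 := v, a + 3 := [(s y, length (s p)) \<in> R]))"
    using Query.prems unfolding lookup.simps
    by (subst exec_answer_query_iff) (auto simp: entry_def)
  moreover have "13 * length (u (y + 3)) + 10 * length (u (p + 3)) + 2 * length (u (a + 3)) + 12
      \<le> 40 * 1 * (n + 1 + 1)" using lens by simp
  moreover have "s(a := [(s y, length (s p)) \<in> R]) =
      regs_from 3 (u(0 := v, a + 3 := [(s y, length (s p)) \<in> R]))"
    using Query.prems(1) by (auto simp: fun_eq_iff)
  ultimately show ?case using Query.prems(2) by (intro exI conjI) (assumption, assumption, auto)
qed

section \<open>Composing a guessed list and running the kernel\<close>

definition read_items :: "nat \<Rightarrow> com" where
  "read_items z = while_bit 7 3 (Seq (unpair 7 3 11) (push_pair 11 z))"

text \<open>Unlike \<open>encode_list\<close>, this code marks the end of the list by a 0, so that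
  further data can follow.\<close>

definition items :: "bitstring list \<Rightarrow> bitstring \<Rightarrow> bitstring" where
  "items ys v = foldr (\<lambda>y u. True # pair y u) ys (False # v)"

text \<open>Any content of register 3 is read as some list, so malformed guesses do no harm. The
  items are pushed one after the other, which reverses their order.\<close>

lemma exec_read_items:
  assumes "s 7 = []" "s 11 = []" "z \<noteq> 3" "z \<noteq> 7" "z \<noteq> 11"
  shows "\<exists>t ys w. exec R (read_items z) s t [] (s(3 := w, z := foldr pair ys (s z))) \<and>
    t \<le> 30 * (length (s 3) + 1)^2 \<and> length w \<le> length (s 3) \<and>
    (\<forall>ys0 v0. s 3 = items ys0 v0 \<longrightarrow> ys = rev ys0 \<and> w = v0)"
  using assms(1,2)
proof (induction "length (s 3)" arbitrary: s rule: less_induct)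
  case less
  show ?case
  proof (cases "\<exists>v. s 3 = True # v")
    case False
    then have stop: "s 3 = [] \<or> (\<exists>v. s 3 = False # v)"
      by (cases "s 3") auto
    have "exec R (read_items z) s 3 [] (s(3 := tl (s 3)))"
      unfolding read_items_def using stop less.prems by (intro exec_while_bit_stop) auto
    moreover have "s(3 := tl (s 3), z := foldr pair [] (s z)) = s(3 := tl (s 3))"
      using assms by (auto simp: fun_eq_iff)
    moreover have "[] = rev ys0 \<and> tl (s 3) = v0" if "s 3 = items ys0 v0" for ys0 v0
      using that False by (cases ys0) (auto simp: items_def)
    moreover have "3 \<le> 30 * (length (s 3) + 1)^2" by (simp add: power2_eq_square)
    ultimately show ?thesis
      by (intro exI[of _ 3] exI[of _ "[]"] exI[of _ "tl (s 3)"]) simp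
  next
    case True
    then obtain v where v: "s 3 = True # v" by blast
    define y where "y = fst (split_pair v)"
    define v' where "v' = snd (split_pair v)"
    have len: "2 * length y + length v' \<le> length v"
      unfolding y_def v'_def by (rule length_split_pair)
    let ?s1 = "s(3 := v)"
    let ?s2 = "?s1(3 := v', 11 := rev y)"
    let ?s3 = "s(3 := v', z := pair y (s z))"
    obtain t1 where 1: "t1 \<le> 8 * length v + 3" "exec R (unpair 7 3 11) ?s1 t1 [] ?s2"
      using exec_unpair[of ?s1 7 3 11 R] less.prems by (auto simp: y_def v'_def)
    have "?s2(11 := [], z := pair (rev (?s2 11)) (?s2 z)) = ?s3"
      using assms less.prems by (auto simp: fun_eq_iff)
    with exec_push_pair[of 11 z R ?s2] assms
    have 2: "exec R (push_pair 11 z) ?s2 (5 * length y + 2) [] ?s3" by simp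
    from exec.Seq[OF 1(2) 2]
    have 12: "exec R (Seq (unpair 7 3 11) (push_pair 11 z)) ?s1 (t1 + (5 * length y + 2)) [] ?s3"
      by (simp del: exec_Seq_iff)
    have "length (?s3 3) < length (s 3)" "?s3 7 = []" "?s3 11 = []"
      using len v assms less.prems by auto
    from less.hyps[OF this] obtain t3 ys w where 3:
      "exec R (read_items z) ?s3 t3 [] (?s3(3 := w, z := foldr pair ys (?s3 z)))"
      "t3 \<le> 30 * (length (?s3 3) + 1)^2" "length w \<le> length (?s3 3)"
      "\<And>ys0 v0. ?s3 3 = items ys0 v0 \<Longrightarrow> ys = rev ys0 \<and> w = v0" by blast
    have s3: "?s3 3 = v'" using assms by simp
    have eq: "?s3(3 := w, z := foldr pair ys (?s3 z)) = s(3 := w, z := foldr pair (ys @ [y]) (s z))"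
      using assms by (auto simp: fun_eq_iff)
    from exec_while_bit_step[OF _ _ v 12 3(1)[unfolded read_items_def]] less.prems
    have "exec R (read_items z) s (t1 + (5 * length y + 2) + t3 + 5) []
        (s(3 := w, z := foldr pair (ys @ [y]) (s z)))"
      unfolding read_items_def eq by simp
    moreover have "t1 + (5 * length y + 2) + t3 + 5 \<le> 30 * (length (s 3) + 1)^2"
    proof -
      define q where "q = (length v + 1)^2"
      have "t3 \<le> 30 * q"
        unfolding q_def using order_trans[OF 3(2)] s3 len by (simp add: power_mono)
      \<comment> \<open>Thirty times the increment of the square pays for the linear cost of one
        iteration.\<close>
      moreover have sq: "(length (s 3) + 1)^2 = q + 2 * (length v + 1) + 1"
        by (simp add: v q_def power2_eq_square)
      ultimately show ?thesis unfolding sq using 1(1) len by simp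
    qed
    moreover have "length w \<le> length (s 3)" using 3(3) s3 len v by simp
    moreover have "ys @ [y] = rev ys0 \<and> w = v0" if "s 3 = items ys0 v0" for ys0 v0
    proof (cases ys0)
      case Nil
      then show ?thesis using that v by (simp add: items_def)
    next
      case (Cons y0 ys1)
      with that v have "v = pair y0 (items ys1 v0)" by (simp add: items_def)
      then have "y = y0" "v' = items ys1 v0" by (simp_all add: y_def v'_def)
      with 3(4)[of ys1 v0] s3 Cons show ?thesis by simp
    qed
    ultimately show ?thesis by blast
  qed
qed

text \<open>The composition delivers its parameter as the length of a register with arbitrary bits,
  while the kernel expects ones.\<close>

definition count_bits :: "nat \<Rightarrow> nat \<Rightarrow> com" where
  "count_bits a b = While a (Seq (Pop a) (Push b True))"

lemma exec_count_bits:
  assumes "a \<noteq> b"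
  shows "exec R (count_bits a b) s (3 * length (s a) + 1) [] (s(a := [], b := unary (length (s a)) @ s b))"
proof (induction "s a" arbitrary: s)
  case Nil
  then show ?case by (auto simp: count_bits_def fun_eq_iff unary_def)
next
  case (Cons x xs)
  let ?s = "s(a := xs, b := True # s b)"
  have 1: "exec R (Seq (Pop a) (Push b True)) s 2 [] ?s" using Cons(2)[symmetric] assms by simp
  have eq: "?s(a := [], b := unary (length (?s a)) @ ?s b) = s(a := [], b := unary (length (s a)) @ s b)"
    using Cons(2)[symmetric] assms
    by (auto simp: fun_eq_iff unary_def replicate_app_Cons_same)
  have "exec R (count_bits a b) ?s (3 * length xs + 1) [] (s(a := [], b := unary (length (s a)) @ s b))"
    using Cons(1)[of ?s, unfolded eq] assms by simp
  from exec.While_step[OF _ 1 this[unfolded count_bits_def]] Cons(2)[symmetric]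
  show ?case unfolding count_bits_def by (simp add: eval_nat_numeral)
qed

text \<open>The guess begins with an index in unary, the number of advice strings to skip. The
  chosen string replaces the advice in register 0.\<close>

definition select_item :: com where
  "select_item = Seq (while_bit 2 6 (Seq (unpair 2 0 1) (clear 1)))
     (Seq (unpair 2 0 1) (Seq (clear 0) (move 1 0)))"

lemma split_pair_encode_list:
  "split_pair (encode_list xs) = (if xs = [] then ([], []) else (hd xs, encode_list (tl xs)))"
  by (cases xs) (auto simp: encode_list_def)

lemma encode_list_Nil [simp]: "encode_list [] = []"
  by (simp add: encode_list_def)

lemma length_encode_list_drop: "length (encode_list (drop i xs)) \<le> length (encode_list xs)"
proof (induction i arbitrary: xs)
  case (Suc i)
  have "length (encode_list (tl xs)) \<le> length (encode_list xs)"
    by (cases xs) (auto simp: encode_list_def)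
  with Suc[of "tl xs"] show ?case by (simp add: drop_Suc)
qed simp

lemma exec_skip_items:
  assumes "s 0 = encode_list xs" "s 1 = []" "s 2 = []"
  shows "\<exists>t i w. exec R (while_bit 2 6 (Seq (unpair 2 0 1) (clear 1))) s t []
      (s(0 := encode_list (drop i xs), 6 := w)) \<and>
    t \<le> (length (s 6) + 1) * (10 * length (encode_list xs) + 20) \<and> length w \<le> length (s 6) \<and>
    (\<forall>j v. s 6 = replicate j True @ False # v \<longrightarrow> i = j \<and> w = v)"
  using assms
proof (induction "length (s 6)" arbitrary: s xs rule: less_induct)
  case less
  show ?case
  proof (cases "\<exists>v. s 6 = True # v")
    case False
    then have stop: "s 6 = [] \<or> (\<exists>v. s 6 = False # v)"
      by (cases "s 6") auto
    have "exec R (while_bit 2 6 (Seq (unpair 2 0 1) (clear 1))) s 3 [] (s(6 := tl (s 6)))"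
      using stop less.prems by (intro exec_while_bit_stop) auto
    moreover have "s(0 := encode_list (drop 0 xs), 6 := tl (s 6)) = s(6 := tl (s 6))"
      using less.prems by (auto simp: fun_eq_iff)
    moreover have "0 = j \<and> tl (s 6) = v" if "s 6 = replicate j True @ False # v" for j v
      using that False by (cases j) auto
    ultimately show ?thesis
      by (intro exI[of _ 3] exI[of _ 0] exI[of _ "tl (s 6)"]) simp
  next
    case True
    then obtain v where v: "s 6 = True # v" by blast
    let ?s1 = "s(6 := v)"
    let ?s2 = "s(6 := v, 0 := encode_list (tl xs), 1 := rev (if xs = [] then [] else hd xs))"
    let ?s3 = "s(6 := v, 0 := encode_list (tl xs))"
    define n where "n = length (encode_list xs)"
    have len: "length (encode_list (tl xs)) \<le> n" "length (if xs = [] then [] else hd xs) \<le> n"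
      by (cases xs; simp add: n_def encode_list_def)+
    have "?s1(0 := snd (split_pair (?s1 0)), 1 := rev (fst (split_pair (?s1 0))) @ ?s1 1) = ?s2"
      using less.prems by (auto simp: split_pair_encode_list fun_eq_iff)
    then obtain t1 where 1: "t1 \<le> 8 * n + 3" "exec R (unpair 2 0 1) ?s1 t1 [] ?s2"
      using exec_unpair[of ?s1 2 0 1 R] less.prems by (auto simp: n_def)
    have "?s2(1 := []) = ?s3" using less.prems by (auto simp: fun_eq_iff)
    with exec_clear[of R 1 ?s2]
    have 2: "exec R (clear 1) ?s2 (2 * length (if xs = [] then [] else hd xs) + 1) [] ?s3" by simp
    from exec.Seq[OF 1(2) 2]
    have 12: "exec R (Seq (unpair 2 0 1) (clear 1)) ?s1
        (t1 + (2 * length (if xs = [] then [] else hd xs) + 1)) [] ?s3"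
      by (simp del: exec_Seq_iff)
    have "length (?s3 6) < length (s 6)" "?s3 0 = encode_list (tl xs)" "?s3 1 = []" "?s3 2 = []"
      using v less.prems by auto
    from less.hyps[OF this] obtain t3 i w where 3:
      "exec R (while_bit 2 6 (Seq (unpair 2 0 1) (clear 1))) ?s3 t3 []
         (?s3(0 := encode_list (drop i (tl xs)), 6 := w))"
      "t3 \<le> (length (?s3 6) + 1) * (10 * length (encode_list (tl xs)) + 20)"
      "length w \<le> length (?s3 6)"
      "\<And>j u. ?s3 6 = replicate j True @ False # u \<Longrightarrow> i = j \<and> w = u" by blast
    have eq: "?s3(0 := encode_list (drop i (tl xs)), 6 := w) =
        s(0 := encode_list (drop (Suc i) xs), 6 := w)"
      by (auto simp: fun_eq_iff drop_Suc)
    from exec_while_bit_step[OF _ _ v 12 3(1)] less.prems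
    have "exec R (while_bit 2 6 (Seq (unpair 2 0 1) (clear 1))) s
        (t1 + (2 * length (if xs = [] then [] else hd xs) + 1) + t3 + 5) []
        (s(0 := encode_list (drop (Suc i) xs), 6 := w))"
      unfolding eq by simp
    moreover have "t1 + (2 * length (if xs = [] then [] else hd xs) + 1) + t3 + 5
        \<le> (length (s 6) + 1) * (10 * length (encode_list xs) + 20)"
    proof -
      have "t3 \<le> (length v + 1) * (10 * n + 20)"
        by (rule order_trans[OF 3(2)]) (use len in \<open>intro mult_le_mono; simp\<close>)
      moreover have "t1 + (2 * length (if xs = [] then [] else hd xs) + 1) + 5 \<le> 10 * n + 20"
        using 1(1) len(2) by linarith
      ultimately show ?thesis using v by (simp add: n_def)
    qed
    moreover have "length w \<le> length (s 6)" using 3(3) v by simp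
    moreover have "Suc i = j \<and> w = u" if "s 6 = replicate j True @ False # u" for j u
    proof (cases j)
      case 0
      then show ?thesis using that v by simp
    next
      case (Suc j')
      with that v 3(4)[of j' u] show ?thesis by simp
    qed
    ultimately show ?thesis by blast
  qed
qed

text \<open>An index beyond the end selects the empty string. This is the transcript without
  entries, so soundness covers it as well.\<close>

lemma exec_select_item:
  assumes "s 0 = encode_list xs" "s 1 = []" "s 2 = []"
  shows "\<exists>t x w. exec R select_item s t [] (s(0 := x, 6 := w)) \<and>
    t \<le> 40 * (length (s 6) + 1) * (length (s 0) + 1) \<and> length w \<le> length (s 6) \<and>
    (x = [] \<or> x \<in> set xs) \<and>
    (\<forall>j v. s 6 = replicate j True @ False # v \<and> j < length xs \<longrightarrow> x = xs ! j \<and> w = v)"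
proof -
  from exec_skip_items[OF assms, of R] obtain t0 i w where 0:
    "exec R (while_bit 2 6 (Seq (unpair 2 0 1) (clear 1))) s t0 []
      (s(0 := encode_list (drop i xs), 6 := w))"
    "t0 \<le> (length (s 6) + 1) * (10 * length (encode_list xs) + 20)" "length w \<le> length (s 6)"
    "\<And>j v. s 6 = replicate j True @ False # v \<Longrightarrow> i = j \<and> w = v" by blast
  define x where "x = (if drop i xs = [] then [] else hd (drop i xs))"
  define s1 where "s1 = s(0 := encode_list (drop i xs), 6 := w)"
  define n where "n = length (encode_list xs)"
  have ii: "length (encode_list (drop i xs)) \<le> n" for i
    unfolding n_def by (rule length_encode_list_drop)
  have len: "length (encode_list (tl (drop i xs))) \<le> n" "length x \<le> n"
    using ii[of i] by (cases "drop i xs"; simp add: x_def encode_list_def)+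
  let ?s2 = "s1(0 := encode_list (tl (drop i xs)), 1 := rev x)"
  have eq: "s1(0 := snd (split_pair (s1 0)), 1 := rev (fst (split_pair (s1 0))) @ s1 1) = ?s2"
    using assms by (auto simp: split_pair_encode_list fun_eq_iff s1_def x_def)
  have "s1 2 = []" "s1 0 = encode_list (drop i xs)" using assms by (auto simp: s1_def)
  with exec_unpair[of s1 2 0 1 R, unfolded eq]
  obtain t1 where "t1 \<le> 8 * length (s1 0) + 3" and 1: "exec R (unpair 2 0 1) s1 t1 [] ?s2"
    by auto
  then have t1: "t1 \<le> 8 * n + 3" using ii[of i] \<open>s1 0 = _\<close> by simp
  let ?s3 = "s1(0 := [], 1 := rev x)"
  have "?s2(0 := []) = ?s3" by (auto simp: fun_eq_iff)
  with exec_clear[of R 0 ?s2]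
  have 2: "exec R (clear 0) ?s2 (2 * length (encode_list (tl (drop i xs))) + 1) [] ?s3" by simp
  have "?s3(1 := [], 0 := rev (?s3 1) @ ?s3 0) = s(0 := x, 6 := w)"
    using assms by (auto simp: s1_def fun_eq_iff)
  with exec_move[of 1 0 R ?s3]
  have 3: "exec R (move 1 0) ?s3 (4 * length x + 1) [] (s(0 := x, 6 := w))" by simp
  from exec.Seq[OF 0(1)[folded s1_def] exec.Seq[OF 1 exec.Seq[OF 2 3]]]
  have "exec R select_item s
    (t0 + (t1 + (2 * length (encode_list (tl (drop i xs))) + 1 + (4 * length x + 1)))) []
    (s(0 := x, 6 := w))"
    unfolding select_item_def by (simp del: exec_Seq_iff)
  moreover have "t0 + (t1 + (2 * length (encode_list (tl (drop i xs))) + 1 + (4 * length x + 1)))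
      \<le> 40 * (length (s 6) + 1) * (length (s 0) + 1)"
  proof -
    have "t0 \<le> (length (s 6) + 1) * (20 * (n + 1))"
      by (rule order_trans[OF 0(2)], rule mult_le_mono2) (simp add: n_def)
    moreover have "t1 + (2 * length (encode_list (tl (drop i xs))) + 1 + (4 * length x + 1)) \<le> 20 * (n + 1)"
      using t1 len by simp
    moreover have "20 * (n + 1) \<le> (length (s 6) + 1) * (20 * (n + 1))" by simp
    moreover have "40 * (length (s 6) + 1) * (length (s 0) + 1) =
        (length (s 6) + 1) * (20 * (n + 1)) + (length (s 6) + 1) * (20 * (n + 1))"
      using assms(1) by (simp add: n_def algebra_simps)
    ultimately show ?thesis by linarith
  qed
  moreover have "x = [] \<or> x \<in> set xs"
    unfolding x_def by (metis hd_in_set in_set_dropD)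
  moreover have "x = xs ! j \<and> w = v" if "s 6 = replicate j True @ False # v" "j < length xs" for j v
    using 0(4)[OF that(1)] that(2) by (simp add: x_def hd_drop_conv_nth)
  ultimately show ?thesis using 0(3) by blast
qed

text \<open>The registers congruent to 0, 1, 2 modulo 4 are the memories of the reduction, the composition and the
  kernel; among the others, 3 holds the guessed strings, 7 is the flag of \<open>read_items\<close>, and 11 is
  scratch space.\<close>
definition run_kernel :: "com \<Rightarrow> com \<Rightarrow> com \<Rightarrow> com" where
  "run_kernel cf cg K = Seq (rename (\<lambda>r. 4 * r) cf) (Seq (read_items 1) (Seq (move 0 11)
     (Seq (push_pair 11 1) (Seq (read_items 1) (Seq (rename (\<lambda>r. 4 * r + 1) cg)
     (Seq (move 1 11) (Seq (move 11 2) (Seq (count_bits 5 6) (rename (\<lambda>r. 4 * r + 2) K)))))))))"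

section \<open>Reduction, composition and kernel as one oracle program\<close>

locale kernel_setting =
  fixes c0 :: nat and R :: param_problem
    and f :: "bitstring \<Rightarrow> bitstring" and cf :: com and qf :: "nat poly"
    and g :: "bitstring list \<Rightarrow> param_inst" and cg :: com and qg :: "nat poly"
    and K :: com and ks :: "param_inst \<Rightarrow> param_inst list" and qk :: "nat poly"
  assumes cf: "\<And>x. \<exists>t s'. runs cf (load [x]) t s' \<and> t \<le> poly qf (length x) \<and> s' 0 = f x"
    and cg: "\<And>xs. xs \<noteq> [] \<Longrightarrow> \<exists>t s'. runs cg (load [encode_list xs]) t s' \<and>
      t \<le> poly qg (\<Sum>x\<leftarrow>xs. length x + 1) \<and> g xs = (s' 0, length (s' 1))"
    and K: "\<And>x p. \<exists>t s'. exec R K (load_inst (x, p)) t (ks (x, p)) s' \<and>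
      t \<le> poly qk (size_inst c0 (x, p)) \<and> s' 0 = [(x, p) \<in> R]"
begin

text \<open>Lengths are bounded by running times: the reduction adds at most \<open>qf\<close> bits;
  \<open>list_poly\<close> counts two runs of \<open>read_items\<close> and one
  \<open>push_pair\<close>; \<open>instance_poly\<close> counts the time of the composition twice,
  for the string and for the parameter.\<close>

definition reduction_poly where "reduction_poly = [:0, 1:] + qf"
definition list_poly where "list_poly = 60 * [:1, 1:]^2 + 5 * reduction_poly + 2"
definition composition_poly where "composition_poly = pcompose qg list_poly"
definition instance_poly where "instance_poly = list_poly + 2 * composition_poly + [:c0:]"
definition run_poly :: "nat poly" where
  "run_poly = qf + 60 * [:1, 1:]^2 + 9 * reduction_poly + 3 + composition_poly +
     11 * instance_poly + 3 + pcompose qk instance_poly"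

lemma sum_list_le_encode_list: "(\<Sum>x\<leftarrow>xs. length x + 1) \<le> length (encode_list xs)"
  by (induction xs) (auto simp: encode_list_def)

text \<open>Whatever \<open>w\<close> is, the composed list contains \<open>f x\<close>, which is
  all that soundness needs; a well-formed guess yields the intended list. The list is built from
  back to front, so \<open>ys\<close> is guessed before \<open>xs\<close>.\<close>

lemma exec_run_kernel:
  "\<exists>xs ys t s'. exec R (run_kernel cf cg K) ((\<lambda>_. [])(0 := x, 3 := w)) t
      (ks (g (xs @ f x # ys))) s' \<and>
    s' 2 = [g (xs @ f x # ys) \<in> R] \<and> t \<le> poly run_poly (length x + length w) \<and>
    (\<forall>xs0 ys0. w = items (rev ys0) (items (rev xs0) []) \<longrightarrow> xs = xs0 \<and> ys = ys0)"
proof -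
  define s0 :: store where "s0 = (\<lambda>_. [])(0 := x, 3 := w)"
  define N where "N = length x + length w"

  obtain t1 sf where f: "exec R cf (load [x]) t1 [] sf" "t1 \<le> poly qf (length x)" "sf 0 = f x"
    using cf[of x] exec_no_query_oracle unfolding runs_def by blast
  have "load [x] = s0 \<circ> (\<lambda>r. 4 * r)"
    by (auto simp: s0_def load_def fun_eq_iff)
  from exec_rename[OF _ f(1) this] obtain s1 where
    1: "exec R (rename (\<lambda>r. 4 * r) cf) s0 t1 [] s1" "s1 \<circ> (\<lambda>r. 4 * r) = sf"
    "\<And>r. r \<notin> range (\<lambda>r. 4 * r) \<Longrightarrow> s1 r = s0 r" by (auto simp: inj_def)
  have s1: "s1 0 = f x" using fun_cong[OF 1(2), of 0] f(3) by simp
  have s1': "s1 r = s0 r" if "r mod 4 \<noteq> 0" for r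
    using that by (intro 1(3)) auto
  have "s1 7 = []" "s1 11 = []" and s1_3: "s1 3 = w" and s1_1: "s1 1 = []"
    using s1'[of 7] s1'[of 11] s1'[of 3] s1'[of 1] by (auto simp: s0_def)
  from exec_read_items[of s1 1 R, OF this(1,2)] obtain t2 ys w2 where
    2: "exec R (read_items 1) s1 t2 [] (s1(3 := w2, 1 := encode_list ys))"
    "t2 \<le> 30 * (length w + 1)^2" "length w2 \<le> length w"
    "\<And>ys0 v0. w = items ys0 v0 \<Longrightarrow> ys = rev ys0 \<and> w2 = v0"
    unfolding s1_3 s1_1 encode_list_def[symmetric] by auto
  define s2 where "s2 = s1(3 := w2, 1 := encode_list ys)"
  define s3 where "s3 = s2(0 := [], 11 := rev (f x))"
  have 3: "exec R (move 0 11) s2 (4 * length (f x) + 1) [] s3"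
    using exec_move[of 0 11 R s2] s1 \<open>s1 11 = []\<close> by (simp add: s2_def s3_def)
  define s4 where "s4 = s3(11 := [], 1 := encode_list (f x # ys))"
  have 4: "exec R (push_pair 11 1) s3 (5 * length (f x) + 2) [] s4"
    using exec_push_pair[of 11 1 R s3] by (simp add: s2_def s3_def s4_def encode_list_def)
  have s4: "s4 7 = []" "s4 11 = []" "s4 3 = w2" "s4 1 = encode_list (f x # ys)"
    using \<open>s1 7 = []\<close> by (simp_all add: s2_def s3_def s4_def)
  have enc: "foldr pair xs (encode_list (f x # ys)) = encode_list (xs @ f x # ys)" for xs
    by (simp add: encode_list_def)
  from exec_read_items[of s4 1 R, OF s4(1,2)] obtain t5 xs w5 where
    5: "exec R (read_items 1) s4 t5 [] (s4(3 := w5, 1 := encode_list (xs @ f x # ys)))"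
    "t5 \<le> 30 * (length w2 + 1)^2"
    "\<And>ys0 v0. w2 = items ys0 v0 \<Longrightarrow> xs = rev ys0 \<and> w5 = v0"
    unfolding s4(3,4) enc by auto
  define zs where "zs = xs @ f x # ys"
  define s5 where "s5 = s4(3 := w5, 1 := encode_list zs)"
  note 5 = 5[folded zs_def, folded s5_def]
  \<comment> \<open>The composition and the kernel must find their banks as \<open>load\<close>
    would leave them.\<close>
  have s5: "s5 r = (if r = 1 then encode_list zs else [])" if "r mod 4 = 1 \<or> r mod 4 = 2 \<or> r = 11" for r
    using that s1'[of r] \<open>s1 11 = []\<close>
    by (auto simp: s5_def s4_def s3_def s2_def s0_def)
  have "zs \<noteq> []" by (simp add: zs_def)
  from cg[OF this] obtain t6 sg where cg: "exec R cg (load [encode_list zs]) t6 [] sg"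
    "t6 \<le> poly qg (\<Sum>x\<leftarrow>zs. length x + 1)" "g zs = (sg 0, length (sg 1))"
    using exec_no_query_oracle unfolding runs_def by blast
  have mod1: "(4 * r + 1) mod 4 = (1 :: nat)" "(4 * r + 2) mod 4 = (2 :: nat)" for r by presburger+
  have "load [encode_list zs] = s5 \<circ> (\<lambda>r. 4 * r + 1)"
    using mod1 by (auto simp: load_def fun_eq_iff s5)
  from exec_rename[OF _ cg(1) this] obtain s6 where
    6: "exec R (rename (\<lambda>r. 4 * r + 1) cg) s5 t6 [] s6" "s6 \<circ> (\<lambda>r. 4 * r + 1) = sg"
    "\<And>r. r \<notin> range (\<lambda>r. 4 * r + 1) \<Longrightarrow> s6 r = s5 r" by (auto simp: inj_def)
  have s6': "s6 r = s5 r" if "r mod 4 \<noteq> 1" for r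
    using that mod1 by (intro 6(3)) auto
  obtain y p where yp: "g zs = (y, p)" by fastforce
  have s6: "s6 1 = y" "length (s6 5) = p"
    using cg(3) yp fun_cong[OF 6(2), of 0] fun_cong[OF 6(2), of 1] by auto
  have s6_bank: "s6 r = []" if "r mod 4 = 2 \<or> r = 11" for r
    using s6'[of r] s5[of r] that by auto
  \<comment> \<open>A move reverses a stack, so \<open>y\<close> travels through register 11 to keep
    its order.\<close>
  define s7 where "s7 = s6(1 := [], 11 := rev y)"
  have 7: "exec R (move 1 11) s6 (4 * length y + 1) [] s7"
    using exec_move[of 1 11 R s6] s6 s6_bank[of 11] by (simp add: s7_def)
  define s8 where "s8 = s7(11 := [], 2 := y)"
  have 8: "exec R (move 11 2) s7 (4 * length y + 1) [] s8"
    using exec_move[of 11 2 R s7] s6_bank[of 2] by (simp add: s7_def s8_def)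
  define s9 where "s9 = s8(5 := [], 6 := unary p)"
  have 9: "exec R (count_bits 5 6) s8 (3 * p + 1) [] s9"
    using exec_count_bits[of 5 6 R s8] s6_bank[of 6] s6(2) by (simp add: s7_def s8_def s9_def)
  have "load_inst (y, p) = s9 \<circ> (\<lambda>r. 4 * r + 2)"
  proof
    fix r
    show "load_inst (y, p) r = (s9 \<circ> (\<lambda>r. 4 * r + 2)) r"
      using s6_bank[OF disjI1, OF mod1(2), of r]
      by (auto simp: load_inst_def load_def s9_def s8_def s7_def nth_Cons' numeral_2_eq_2)
  qed
  moreover obtain t10 sk where k: "exec R K (load_inst (y, p)) t10 (ks (y, p)) sk"
    "t10 \<le> poly qk (size_inst c0 (y, p))" "sk 0 = [(y, p) \<in> R]" using K by blast
  ultimately obtain s10 where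
    10: "exec R (rename (\<lambda>r. 4 * r + 2) K) s9 t10 (ks (y, p)) s10" "s10 \<circ> (\<lambda>r. 4 * r + 2) = sk"
    using exec_rename[OF _ k(1), of "\<lambda>r. 4 * r + 2"] by (auto simp: inj_def)
  have "s10 2 = [g zs \<in> R]" using fun_cong[OF 10(2), of 0] k(3) yp by (simp add: numeral_2_eq_2)
  moreover from exec.Seq[OF 1(1) exec.Seq[OF 2(1)[folded s2_def] exec.Seq[OF 3 exec.Seq[OF 4
    exec.Seq[OF 5(1) exec.Seq[OF 6(1) exec.Seq[OF 7 exec.Seq[OF 8 exec.Seq[OF 9 10(1)]]]]]]]]]
  have "exec R (run_kernel cf cg K) s0 (t1 + (t2 + (4 * length (f x) + 1 + (5 * length (f x) + 2 +
     (t5 + (t6 + (4 * length y + 1 + (4 * length y + 1 + (3 * p + 1 + t10))))))))) (ks (g zs)) s10"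
    unfolding run_kernel_def yp by (simp del: exec_Seq_iff)
  moreover have "t1 + (t2 + (4 * length (f x) + 1 + (5 * length (f x) + 2 +
     (t5 + (t6 + (4 * length y + 1 + (4 * length y + 1 + (3 * p + 1 + t10)))))))) \<le> poly run_poly N"
  proof -
    define q where "q = (N + 1)^2"
    have t1: "t1 \<le> poly qf N" using order_trans[OF f(2) poly_nat_mono] by (simp add: N_def)
    have "length (f x) \<le> length x + t1"
      using exec_length_le[OF f(1), of 0] f(3) by (simp add: load_def)
    then have fx: "length (f x) \<le> poly reduction_poly N" using t1 by (simp add: reduction_poly_def N_def)
    have "(length w + 1)^2 \<le> q" "(length w2 + 1)^2 \<le> q"
      unfolding q_def N_def using 2(3) by (auto intro!: power_mono)
    then have t25: "t2 \<le> 30 * q" "t5 \<le> 30 * q" using 2(2) 5(2) by linarith+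
    have "length (encode_list ys) \<le> t2"
      using exec_length_le[OF 2(1), of 1] s1_1 by simp
    moreover have "length (encode_list (f x # ys)) \<le> length (encode_list ys) + (5 * length (f x) + 2)"
      by (simp add: encode_list_def)
    moreover have "length (encode_list zs) \<le> length (encode_list (f x # ys)) + t5"
      using exec_length_le[OF 5(1), of 1] s4(4) by (simp add: s5_def)
    moreover have list_poly: "poly list_poly N = 60 * q + 5 * poly reduction_poly N + 2"
      by (simp add: list_poly_def q_def algebra_simps)
    ultimately have zs: "length (encode_list zs) \<le> poly list_poly N" using t25 fx by linarith
    with sum_list_le_encode_list[of zs] have "(\<Sum>x\<leftarrow>zs. length x + 1) \<le> poly list_poly N" by linarith
    from order_trans[OF cg(2) poly_nat_mono[OF this]]
    have t6: "t6 \<le> poly composition_poly N" by (simp add: composition_poly_def poly_pcompose)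
    have "length y \<le> length (encode_list zs) + t6" "p \<le> t6"
      using exec_length_le[OF cg(1), of 0] exec_length_le[OF cg(1), of 1] cg(3) yp
      by (auto simp: load_def)
    moreover have instance_poly: "poly instance_poly N = poly list_poly N + 2 * poly composition_poly N + c0"
      by (simp add: instance_poly_def)
    ultimately have size: "size_inst c0 (y, p) \<le> poly instance_poly N" 
        "length y \<le> poly instance_poly N" "p \<le> poly instance_poly N"
      using zs t6 by (simp_all add: size_inst_def)
    have t10: "t10 \<le> poly qk (poly instance_poly N)"
      using order_trans[OF k(2) poly_nat_mono[OF size(1)]] .
    have "poly run_poly N = poly qf N + 60 * q + 9 * poly reduction_poly N + 3 +
        poly composition_poly N + 11 * poly instance_poly N + 3
        + poly qk (poly instance_poly N)"
      by (simp add: run_poly_def q_def poly_pcompose algebra_simps)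
    then show ?thesis using t1 t25 fx t6 size t10 by linarith
  qed
  moreover have "xs = xs0 \<and> ys = ys0" if "w = items (rev ys0) (items (rev xs0) [])" for xs0 ys0
    using 2(4)[OF that] 5(3) by simp
  ultimately show ?thesis unfolding zs_def s0_def N_def by blast
qed

text \<open>Halting certifies a composed instance outside \<open>R\<close>, hence a list without
  members of \<open>L\<close>.\<close>

definition run_and_reject :: com where
  "run_and_reject = Seq (run_kernel cf cg K) (Branch 2 diverge Skip Skip)"

lemma exec_run_and_reject_sound:
  assumes "exec R run_and_reject ((\<lambda>_. [])(0 := x, 3 := w)) t qs s'"
  shows "\<exists>xs ys. g (xs @ f x # ys) \<notin> R"
proof -
  from exec_run_kernel[of x w] obtain xs ys t1 s1 where
    1: "exec R (run_kernel cf cg K) ((\<lambda>_. [])(0 := x, 3 := w)) t1 (ks (g (xs @ f x # ys))) s1"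
    "s1 2 = [g (xs @ f x # ys) \<in> R]" by blast
  from assms obtain t2 qs2 where "exec R (Branch 2 diverge Skip Skip) s1 t2 qs2 s'"
    unfolding run_and_reject_def exec_Seq_iff[of R "run_kernel cf cg K"] using exec_deterministic[OF 1(1)] by blast
  then show ?thesis using 1(2) by (auto split: if_splits)
qed

lemma exec_run_and_reject:
  assumes "g (xs @ f x # ys) \<notin> R"
  shows "\<exists>t s'. exec R run_and_reject ((\<lambda>_. [])(0 := x, 3 := items (rev ys) (items (rev xs) []))) t
    (ks (g (xs @ f x # ys))) s' \<and>
    t \<le> poly run_poly (length x + length (items (rev ys) (items (rev xs) []))) + 2"
proof -
  let ?w = "items (rev ys) (items (rev xs) [])"
  from exec_run_kernel[of x ?w] obtain t1 s1 where
    1: "exec R (run_kernel cf cg K) ((\<lambda>_. [])(0 := x, 3 := ?w)) t1 (ks (g (xs @ f x # ys))) s1"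
    "s1 2 = [g (xs @ f x # ys) \<in> R]" "t1 \<le> poly run_poly (length x + length ?w)" by blast
  have "exec R (Branch 2 diverge Skip Skip) s1 2 [] s1" using 1(2) assms by simp
  from exec.Seq[OF 1(1) this] 1(3) show ?thesis
    unfolding run_and_reject_def by (intro exI[of _ "t1 + 2"] exI[of _ s1]) (simp del: exec_Seq_iff)
qed

end

section \<open>Covering by transcripts\<close>

text \<open>A tuple with value \<open>u\<close> has all entries in \<open>C u\<close>. If each
  \<open>C u\<close> were smaller than half of \<open>S\<close>, then
  \<open>2 * card (C u) \<le> card S - 1\<close> by integrality, and at most \<open>2 ^ N\<close>
  such powers could not add up to \<open>card S ^ N\<close>.\<close>

lemma half_cover:
  fixes \<tau> :: "'a list \<Rightarrow> 'b"
  assumes "finite S" "finite U" "card U \<le> 2 ^ N" "N > 0"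
    and \<tau>: "\<And>xs. set xs \<subseteq> S \<Longrightarrow> length xs = N \<Longrightarrow> \<tau> xs \<in> U"
  shows "\<exists>u. card S \<le> 2 * card {x \<in> S. \<exists>xs. set xs \<subseteq> S \<and> length xs = N \<and> x \<in> set xs \<and> \<tau> xs = u}"
proof (rule ccontr)
  define C where "C u = {x \<in> S. \<exists>xs. set xs \<subseteq> S \<and> length xs = N \<and> x \<in> set xs \<and> \<tau> xs = u}" for u
  assume "\<not> ?thesis"
  then have less: "2 * card (C u) < card S" for u by (auto simp: C_def not_le)
  have finC: "finite (C u)" for u using assms(1) by (simp add: C_def)
  have "{xs. set xs \<subseteq> S \<and> length xs = N} \<subseteq> (\<Union>u\<in>U. {xs. set xs \<subseteq> C u \<and> length xs = N})"
    using \<tau> by (auto simp: C_def)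
  then have "card {xs. set xs \<subseteq> S \<and> length xs = N} \<le>
      card (\<Union>u\<in>U. {xs. set xs \<subseteq> C u \<and> length xs = N})"
    using assms(2) finC by (intro card_mono) (auto simp: finite_lists_length_eq)
  also have "\<dots> \<le> (\<Sum>u\<in>U. card {xs. set xs \<subseteq> C u \<and> length xs = N})"
    by (rule card_UN_le[OF assms(2)])
  finally have "card S ^ N \<le> (\<Sum>u\<in>U. card (C u) ^ N)"
    using assms(1) finC by (simp add: card_lists_length_eq)
  then have "2 ^ N * card S ^ N \<le> (\<Sum>u\<in>U. (2 * card (C u)) ^ N)"
    by (simp add: power_mult_distrib flip: sum_distrib_left)
  also have "\<dots> \<le> (\<Sum>u\<in>U. (card S - 1) ^ N)"
  proof (intro sum_mono power_mono)
    show "2 * card (C u) \<le> card S - 1" for u using less[of u] by simp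
  qed simp
  also have "\<dots> \<le> 2 ^ N * (card S - 1) ^ N" using assms(3) by simp
  finally have "card S ^ N \<le> (card S - 1) ^ N" by simp
  \<comment> \<open>The negated claim concerns every \<open>u\<close>, inside \<open>U\<close> or
    not, so any single one shows that \<open>S\<close> is nonempty.\<close>
  moreover have "card S > 0" using less[of undefined] by simp
  then have "(card S - 1) ^ N < card S ^ N" using assms(4) by (intro power_strict_mono) auto
  ultimately show False by simp
qed

text \<open>Each round covers at least half of what is left, so fewer than \<open>2 ^ k\<close>
  elements are exhausted after \<open>k\<close> rounds. Tuples over the rest are also tuples over
  \<open>S\<close>.\<close>

lemma ex_small_cover:
  fixes \<tau> :: "'a list \<Rightarrow> 'b"
  assumes "finite S" "finite U" "card U \<le> 2 ^ N" "N > 0"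
    and "\<And>xs. set xs \<subseteq> S \<Longrightarrow> length xs = N \<Longrightarrow> \<tau> xs \<in> U" and "card S < 2 ^ k"
  shows "\<exists>us. length us \<le> k \<and>
    (\<forall>x\<in>S. \<exists>xs. set xs \<subseteq> S \<and> length xs = N \<and> x \<in> set xs \<and> \<tau> xs \<in> set us)"
  using assms(1,5,6)
proof (induction k arbitrary: S)
  case 0
  then show ?case by auto
next
  case (Suc k)
  obtain u where u: "card S \<le>
      2 * card {x \<in> S. \<exists>xs. set xs \<subseteq> S \<and> length xs = N \<and> x \<in> set xs \<and> \<tau> xs = u}" (is "_ \<le> 2 * card ?C")
    using half_cover[of S U N \<tau>] Suc.prems assms(2-4) by blast
  have "card (S - ?C) = card S - card ?C"
    using Suc.prems(1) by (intro card_Diff_subset) auto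
  then have "card (S - ?C) < 2 ^ k" using u Suc.prems(3) by simp
  moreover have "finite (S - ?C)" using Suc.prems(1) by simp
  moreover have "\<tau> ys \<in> U" if "set ys \<subseteq> S - ?C" "length ys = N" for ys
    using that by (intro Suc.prems(2)) auto
  ultimately obtain us where us: "length us \<le> k" "\<And>x. x \<in> S - ?C \<Longrightarrow>
      \<exists>xs. set xs \<subseteq> S - ?C \<and> length xs = N \<and> x \<in> set xs \<and> \<tau> xs \<in> set us"
    using Suc.IH[of "S - ?C"] by blast
  have "\<exists>xs. set xs \<subseteq> S \<and> length xs = N \<and> x \<in> set xs \<and> \<tau> xs \<in> set (u # us)" if "x \<in> S" for x
  proof (cases "x \<in> ?C")
    case False
    with that have "x \<in> S - ?C" by blast
    from us(2)[OF this] show ?thesis by (elim exE) (auto intro!: exI)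
  qed auto
  then show ?case using us(1) by (intro exI[of _ "u # us"]) simp
qed

lemma card_bitstrings_less: "card {v :: bitstring. length v < N} < 2 ^ N"
proof (cases N)
  case (Suc m)
  have "{v :: bitstring. length v < N} = {v. set v \<subseteq> UNIV \<and> length v \<le> m}"
    using Suc by auto
  then have "card {v :: bitstring. length v < N} = (\<Sum>i\<le>m. 2 ^ i)"
    by (simp only: card_lists_length_le finite_UNIV card_UNIV_bool)
  also have "\<dots> < 2 ^ N"
    unfolding Suc by (induction m) auto
  finally show ?thesis .
qed simp

lemma finite_bitstrings_less: "finite {v :: bitstring. length v < N}"
  by (rule finite_subset[OF _ finite_lists_length_le[of UNIV N]]) auto

lemma length_items: "length (items ys v) = (\<Sum>y\<leftarrow>ys. 2 * length y + 2) + 1 + length v"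
  by (induction ys) (auto simp: items_def)

lemma length_encode_list: "length (encode_list xs) = (\<Sum>x\<leftarrow>xs. 2 * length x + 1)"
  by (induction xs) (auto simp: encode_list_def)

lemma sum_list_bound: "(\<And>x. x \<in> set xs \<Longrightarrow> h x \<le> c) \<Longrightarrow> (\<Sum>x\<leftarrow>xs. h x) \<le> length xs * (c :: nat)"
  using sum_list_mono[of xs h "\<lambda>_. c"] by (simp add: sum_list_triv)

section \<open>The nondeterministic machine and its advice\<close>

context kernel_setting
begin

definition transcript :: "bitstring list \<Rightarrow> bitstring" where
  "transcript zs = foldr (entry R) (ks (g zs)) []"

definition machine :: com where
  "machine = Seq select_item (lookup run_and_reject)"

text \<open>Whatever the guess selects, be it a transcript or the empty string, is a list of true
  entries, so \<open>lookup_sound\<close> applies.\<close>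

lemma machine_sound:
  assumes "runs machine (machine_input (encode_list (map transcript zss)) x w) t s'"
  shows "\<exists>xs ys. g (xs @ f x # ys) \<notin> R"
proof -
  let ?s = "machine_input (encode_list (map transcript zss)) x w"
  from exec_select_item[of ?s "map transcript zss" "{}"] obtain t1 T w' where
    1: "exec {} select_item ?s t1 [] (?s(0 := T, 6 := w'))" and T: "T = [] \<or> T \<in> transcript ` set zss"
    by (auto simp: machine_input_def)
  from assms obtain t2 where 2: "exec {} (lookup run_and_reject) (?s(0 := T, 6 := w')) t2 [] s'"
    using exec_deterministic[OF 1] by (auto simp: runs_def machine_def)
  have "T = foldr (entry R) [] [] \<or> (\<exists>zs. T = foldr (entry R) (ks (g zs)) [])"
    using T by (auto simp: transcript_def)
  then obtain qs where "T = foldr (entry R) qs []" by blast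
  then have "(?s(0 := T, 6 := w')) 1 = []" "(?s(0 := T, 6 := w')) 0 = foldr (entry R) qs []"
    by (simp_all add: machine_input_def)
  from lookup_sound[OF 2 this] obtain t3 qs3 where
    "exec R run_and_reject (regs_from 3 (?s(0 := T, 6 := w'))) t3 qs3 (regs_from 3 s')" by blast
  moreover have "regs_from 3 (?s(0 := T, 6 := w')) = (\<lambda>_. [])(0 := x, 3 := w')"
    by (auto simp: machine_input_def fun_eq_iff)
  ultimately show ?thesis using exec_run_and_reject_sound by simp
qed

text \<open>Only the transcript as a string matters, not the list it was recorded for. The guess
  consists of the index \<open>j\<close> in unary and the two parts of the list around
  \<open>f x\<close>.\<close>

lemma machine_complete:
  assumes "g (xs @ f x # ys) \<notin> R" and "j < length zss" and "transcript (zss ! j) = transcript (xs @ f x # ys)"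
    and "length (items (rev ys) (items (rev xs) [])) \<le> n" and "j \<le> n" "length x \<le> n"
    and "length (encode_list (map transcript zss)) \<le> m"
  shows "\<exists>w t s'. length w \<le> 2 * n + 1 \<and>
    t \<le> 40 * (2 * n + 2) * (m + 1) +
      40 * (poly run_poly (2 * n) + 2) * (2 * n + (poly run_poly (2 * n) + 2) + 1) \<and>
    runs machine (machine_input (encode_list (map transcript zss)) x w) t s'"
proof -
  let ?v = "items (rev ys) (items (rev xs) [])"
  define w where "w = replicate j True @ False # ?v"
  have w: "length w \<le> 2 * n + 1" using assms(4,5) by (simp add: w_def)
  let ?a = "encode_list (map transcript zss)"
  let ?s = "machine_input ?a x w"
  have "?s 6 = replicate j True @ False # ?v" by (simp add: machine_input_def w_def)
  moreover from exec_select_item[of ?s "map transcript zss" "{}"] obtain t1 T w' where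
    1: "exec {} select_item ?s t1 [] (?s(0 := T, 6 := w'))"
      "t1 \<le> 40 * (length w + 1) * (length ?a + 1)"
    and T: "\<And>j v. ?s 6 = replicate j True @ False # v \<Longrightarrow> j < length zss \<Longrightarrow>
      T = transcript (zss ! j) \<and> w' = v"
    by (auto simp: machine_input_def)
  ultimately have T: "T = transcript (xs @ f x # ys)" "w' = ?v"
    using assms(2,3) by simp_all
  have t1: "t1 \<le> 40 * (2 * n + 2) * (m + 1)"
    by (rule order_trans[OF 1(2)]) (use w assms(7) in \<open>intro mult_le_mono; simp\<close>)
  let ?s1 = "?s(0 := T, 6 := w')" and ?p = "(\<lambda>_. [] :: bitstring)(0 := x, 3 := ?v)"
  define P where "P = poly run_poly (2 * n) + 2"
  obtain t2 s2 where 2: "exec R run_and_reject ?p t2 (ks (g (xs @ f x # ys))) s2"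
    "t2 \<le> poly run_poly (length x + length ?v) + 2" using exec_run_and_reject[OF assms(1)] by blast
  have "length x + length ?v \<le> 2 * n" using assms(4,6) by simp
  from poly_nat_mono[OF this, of run_poly] have t2: "t2 \<le> P" using 2(2) by (simp add: P_def)
  have "?p = regs_from 3 ?s1" using T(2) by (auto simp: machine_input_def fun_eq_iff)
  moreover have "?s1 1 = []" by (simp add: machine_input_def)
  moreover have "?s1 0 = foldr (entry R) (ks (g (xs @ f x # ys))) []"
    using T(1) by (simp add: transcript_def)
  moreover have "length (?p r) \<le> n" for r using assms(4,6) by simp
  ultimately obtain t3 s3 where 3: "exec {} (lookup run_and_reject) ?s1 t3 [] s3" "t3 \<le> 40 * t2 * (n + t2 + 1)"
    using lookup_complete[OF 2(1), of ?s1 "[]" n] by blast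
  have "t3 \<le> 40 * P * (2 * n + P + 1)"
    by (rule order_trans[OF 3(2)]) (use t2 in \<open>intro mult_le_mono; simp\<close>)
  moreover from exec.Seq[OF 1(1) 3(1)] have "runs machine ?s (t1 + t3) s3"
    by (simp add: runs_def machine_def del: exec_Seq_iff)
  ultimately show ?thesis using w t1 unfolding P_def by (intro exI[of _ w] exI[of _ "t1 + t3"]) auto
qed

lemma length_f: "length (f x) \<le> poly reduction_poly (length x)"
proof -
  obtain t s' where 1: "exec {} cf (load [x]) t [] s'" "t \<le> poly qf (length x)" "s' 0 = f x"
    using cf[of x] unfolding runs_def by blast
  from exec_length_le[OF 1(1), of 0] 1 show ?thesis by (simp add: load_def reduction_poly_def)
qed

text \<open>\<open>poly N n\<close> is the length of the tuples. Transcripts with fewer bits than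
  that take fewer than \<open>2 ^ poly N n\<close> values, which is what the covering argument
  requires.\<close>

lemma coNP_poly_advice:
  assumes g: "\<And>zs. zs \<noteq> [] \<Longrightarrow> g zs \<in> R \<longleftrightarrow> (\<exists>z \<in> set zs. z \<in> L)"
    and f: "\<And>x. x \<in> A \<longleftrightarrow> f x \<in> L"
    and short: "\<And>n zs. length zs = poly N n \<Longrightarrow> (\<And>z. z \<in> set zs \<Longrightarrow> length z \<le> poly reduction_poly n) \<Longrightarrow>
      length (transcript zs) < poly N n"
    and N_pos: "\<And>n. poly N n > 0"
  shows "A \<in> with_poly_advice class_coNP"
proof -
  define S where "S n = {x. length x = n \<and> x \<notin> A}" for n
  have finS: "finite (S n)" for n
    by (rule finite_subset[OF _ finite_bitstrings_less[of "n + 1"]]) (auto simp: S_def)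
  \<comment> \<open>Counting all strings shorter than \<open>n + 1\<close> gives the strict bound
    that makes \<open>n + 1\<close> rounds suffice.\<close>
  have cardS: "card (S n) < 2 ^ (n + 1)" for n
    by (rule le_less_trans[OF card_mono[OF finite_bitstrings_less] card_bitstrings_less])
      (auto simp: S_def)
  have "\<exists>us. length us \<le> n + 1 \<and> (\<forall>x\<in>S n. \<exists>xs. set xs \<subseteq> S n \<and> length xs = poly N n \<and> x \<in> set xs \<and>
      transcript (map f xs) \<in> set us)" for n
  proof (rule ex_small_cover[OF finS finite_bitstrings_less _ N_pos _ cardS])
    show "card {v :: bitstring. length v < poly N n} \<le> 2 ^ poly N n"
      using card_bitstrings_less by (rule less_imp_le)
  next
    fix xs assume xs: "set xs \<subseteq> S n" "length xs = poly N n"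
    have "length (transcript (map f xs)) < poly N n"
    proof (rule short)
      fix z assume "z \<in> set (map f xs)"
      then obtain x where "z = f x" "length x = n" using xs by (auto simp: S_def)
      then show "length z \<le> poly reduction_poly n" using length_f[of x] by simp
    qed (use xs in simp)
    then show "transcript (map f xs) \<in> {v. length v < poly N n}" by simp
  qed
  then obtain us where us: "\<And>n. length (us n) \<le> n + 1"
    "\<And>n x. x \<in> S n \<Longrightarrow> \<exists>xs. set xs \<subseteq> S n \<and> length xs = poly N n \<and> x \<in> set xs \<and>
      transcript (map f xs) \<in> set (us n)" by metis
  \<comment> \<open>The cover is not known to consist of transcripts. Everything else is dropped:
    being a transcript makes the advice sound, being short makes it polynomial.\<close>
  define us' where "us' n = filter (\<lambda>u. u \<in> range transcript \<and> length u < poly N n) (us n)" for n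
  have "\<exists>zss. us' n = map transcript zss" for n
    unfolding ex_map_conv by (auto simp: us'_def)
  then obtain zss where zss: "\<And>n. us' n = map transcript (zss n)" by metis
  have len_zss: "length (zss n) \<le> n + 1" for n
  proof -
    have "length (zss n) = length (us' n)" by (simp add: zss)
    also have "\<dots> \<le> length (us n)" by (simp add: us'_def)
    finally show ?thesis using us(1)[of n] by simp
  qed
  define a where "a n = encode_list (map transcript (zss n))" for n
  \<comment> \<open>\<open>pm\<close> bounds the advice: at most \<open>n + 1\<close> transcripts,
    each coded in at most \<open>2 * poly N n + 1\<close> bits. \<open>pn\<close> bounds the index,
    the instance and the guessed list, whose two end marks give the final 2.\<close>
  define pm where "pm = [:1, 1:] * (2 * N + 1)"
  define pn where "pn = [:1, 1:] + N * (2 * reduction_poly + 2) + 2"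
  define pl where "pl = pcompose run_poly (2 * pn)"
  define q where "q = pm + 2 * pn + 1 + 40 * (2 * pn + 2) * (pm + 1) + 40 * (pl + 2) * (2 * pn + (pl + 2) + 1)"
  have len_a: "length (a n) \<le> poly pm n" for n
  proof -
    have "length (a n) = (\<Sum>u\<leftarrow>us' n. 2 * length u + 1)"
      by (simp add: a_def length_encode_list flip: zss)
    also have "\<dots> \<le> length (us' n) * (2 * poly N n + 1)"
      by (rule sum_list_bound) (auto simp: us'_def)
    also have "\<dots> \<le> (n + 1) * (2 * poly N n + 1)"
      using len_zss[of n] zss[of n] by (intro mult_le_mono1) simp
    finally show ?thesis by (simp add: pm_def)
  qed
  show ?thesis
  proof (rule coNP_poly_advice_I)
    fix n
    show "length (a n) \<le> poly q n" using len_a[of n] by (simp add: q_def)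
  next
    fix x w t s' assume "x \<in> A"
    show "\<not> runs machine (machine_input (a (length x)) x w) t s'"
    proof
      assume "runs machine (machine_input (a (length x)) x w) t s'"
      from machine_sound[OF this[unfolded a_def]] obtain xs ys where "g (xs @ f x # ys) \<notin> R" by blast
      with g[of "xs @ f x # ys"] f[of x] \<open>x \<in> A\<close> show False by simp
    qed
  next
    fix x assume x: "x \<notin> A"
    define n where "n = length x"
    have "x \<in> S n" using x by (simp add: S_def n_def)
    from us(2)[OF this] obtain xs where xs: "set xs \<subseteq> S n" "length xs = poly N n" "x \<in> set xs"
      "transcript (map f xs) \<in> set (us n)" by blast
    from split_list[OF xs(3)] obtain xs1 xs2 where split: "xs = xs1 @ x # xs2" by blast
    have len_f: "length (f z) \<le> poly reduction_poly n" if "z \<in> set xs" for z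
      using that xs(1) length_f[of z] by (auto simp: S_def)
    have "length (transcript (map f xs)) < poly N n"
      using xs(2) len_f by (intro short) auto
    with xs(4) have "transcript (map f xs) \<in> set (us' n)" by (simp add: us'_def)
    then obtain j where j: "j < length (us' n)" "us' n ! j = transcript (map f xs)"
      by (auto simp: in_set_conv_nth)
    \<comment> \<open>All strings of the tuple lie outside \<open>A\<close>, so their disjunction is
      false.\<close>
    have g_no: "g (map f xs1 @ f x # map f xs2) \<notin> R"
      using g[of "map f xs1 @ f x # map f xs2"] f xs(1) by (auto simp: split S_def)
    have "length (items (rev (map f xs2)) (items (rev (map f xs1)) [])) =
        (\<Sum>y\<leftarrow>map f xs1 @ map f xs2. 2 * length y + 2) + 2"
      by (simp add: length_items rev_map[symmetric] sum_list_rev del: sum_list_append)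
        (simp add: sum_list_append)
    also have "\<dots> \<le> length (map f xs1 @ map f xs2) * (2 * poly reduction_poly n + 2) + 2"
      by (intro add_right_mono sum_list_bound) (use len_f split in auto)
    also have "\<dots> \<le> poly N n * (2 * poly reduction_poly n + 2) + 2"
      using xs(2) split by (intro add_right_mono mult_le_mono1) simp
    finally have items: "length (items (rev (map f xs2)) (items (rev (map f xs1)) [])) \<le> poly pn n"
      by (simp add: pn_def)
    have "j \<le> poly pn n" "length x \<le> poly pn n"
      using j(1) len_zss[of n] zss[of n] by (simp_all add: pn_def n_def)
    from machine_complete[OF g_no _ _ items this, of "zss n" "poly pm n"] j zss[of n] len_a[of n] split
    obtain w t s' where w: "length w \<le> 2 * poly pn n + 1"
      "t \<le> 40 * (2 * poly pn n + 2) * (poly pm n + 1) +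
        40 * (poly run_poly (2 * poly pn n) + 2) *
          (2 * poly pn n + (poly run_poly (2 * poly pn n) + 2) + 1)"
      "runs machine (machine_input (a n) x w) t s'"
      by (auto simp: a_def)
    have q: "poly q n = (poly pm n + 2 * poly pn n + 1) + (40 * (2 * poly pn n + 2) * (poly pm n + 1) +
        40 * (poly run_poly (2 * poly pn n) + 2) *
          (2 * poly pn n + (poly run_poly (2 * poly pn n) + 2) + 1))"
      by (simp add: q_def pl_def poly_pcompose algebra_simps)
    have "length w \<le> poly q n" unfolding q using w(1) by simp
    moreover have "t \<le> poly q n" unfolding q using w(2) by (rule trans_le_add2)
    ultimately show "\<exists>w t s'. length w \<le> poly q (length x) \<and> t \<le> poly q (length x) \<and>
        runs machine (machine_input (a (length x)) x w) t s'"
      using w(3) unfolding n_def by blast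
  qed
qed

end

section \<open>The length of transcripts\<close>

text \<open>The base is at least 2 even for \<open>n = 0\<close>, so a coefficient \<open>c\<close>
  is absorbed by adding \<open>c\<close> to the exponent.\<close>

lemma poly_nat_le_power: "\<exists>k. \<forall>n. poly (p :: nat poly) n \<le> (n + 2) ^ k"
proof (induction p)
  case 0
  then show ?case by simp
next
  case (pCons c p)
  then obtain k where k: "\<And>n. poly p n \<le> (n + 2) ^ k" by blast
  have "poly (pCons c p) n \<le> (n + 2) ^ (k + c + 1)" for n
  proof -
    have "c < 2 ^ c" by (rule less_exp)
    also have "(2 :: nat) ^ c \<le> (n + 2) ^ (k + c)"
      by (rule order_trans[OF power_mono[of 2 "n + 2"] power_increasing]) auto
    finally have c: "c \<le> (n + 2) ^ (k + c)" by simp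
    have "n * poly p n \<le> (n + 1) * (n + 2) ^ (k + c)"
      by (intro mult_le_mono order_trans[OF k power_increasing]) auto
    with c have "poly (pCons c p) n \<le> (n + 2) ^ (k + c) + (n + 1) * (n + 2) ^ (k + c)" by simp
    also have "\<dots> = (n + 2) ^ (k + c + 1)" by (simp add: algebra_simps)
    finally show ?thesis .
  qed
  then show ?case by blast
qed

lemma poly_real_le_power: "\<exists>C k. C \<ge> 1 \<and> (\<forall>x \<ge> 0. \<bar>poly (p :: real poly) x\<bar> \<le> C * (1 + x) ^ k)"
proof (induction p)
  case 0
  then show ?case by (intro exI[of _ 1] exI[of _ 0]) simp
next
  case (pCons c p)
  then obtain C k where C: "C \<ge> 1" "\<And>x. x \<ge> 0 \<Longrightarrow> \<bar>poly p x\<bar> \<le> C * (1 + x) ^ k" by blast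
  have "\<bar>poly (pCons c p) x\<bar> \<le> (\<bar>c\<bar> + C) * (1 + x) ^ (k + 1)" if x: "x \<ge> 0" for x
  proof -
    have one: "1 \<le> (1 + x) ^ (k + 1)" using x by (intro one_le_power) simp
    have "\<bar>poly (pCons c p) x\<bar> \<le> \<bar>c\<bar> + x * \<bar>poly p x\<bar>"
      using x by (simp add: abs_mult order_trans[OF abs_triangle_ineq])
    also have "\<dots> \<le> \<bar>c\<bar> * (1 + x) ^ (k + 1) + (1 + x) * (C * (1 + x) ^ k)"
      using x C mult_left_mono[OF one, of "\<bar>c\<bar>"] by (intro add_mono mult_mono) auto
    finally show ?thesis by (simp add: algebra_simps)
  qed
  then show ?case using C(1) by (intro exI[of _ "\<bar>c\<bar> + C"] exI[of _ "k + 1"]) auto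
qed

text \<open>This is \<open>ln u \<le> u\<close> at \<open>u = t powr \<delta>\<close>; it trades
  logarithms for an arbitrarily small power.\<close>

lemma one_plus_log_le_powr:
  assumes "\<delta> > 0" "t \<ge> 1"
  shows "1 + log 2 t \<le> (1 + 1 / (\<delta> * ln 2)) * t powr \<delta>"
proof -
  have "\<delta> * ln t = ln (t powr \<delta>)" using assms by (simp add: ln_powr)
  also have "\<dots> \<le> t powr \<delta>" using ln_bound[of "t powr \<delta>"] assms by simp
  finally have "log 2 t \<le> 1 / (\<delta> * ln 2) * t powr \<delta>"
    using assms by (simp add: log_def field_simps)
  moreover have "1 \<le> t powr \<delta>" using assms by (simp add: ge_one_powr_ge_zero)
  ultimately show ?thesis by (simp add: algebra_simps)
qed

text \<open>The query bound saves a factor \<open>t powr \<epsilon>\<close>. One half of the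
  exponent absorbs the logarithms, the other one the polynomial in \<open>n\<close> and the
  constants, once \<open>t\<close> is a large power of \<open>n + E\<close>.\<close>

lemma ex_tuple_length:
  fixes P :: "nat poly" and C \<epsilon> :: real
  assumes "0 < \<epsilon>" "C > 0"
  shows "\<exists>N :: nat poly. \<forall>n. poly N n > 0 \<and>
    C * real (poly N n) powr (1 - \<epsilon>) * ((1 + real (poly P n)) * (1 + log 2 (real (poly N n)))) ^ k
      < real (poly N n)"
proof -
  obtain j where j: "\<And>n. poly (P + 1) n \<le> (n + 2) ^ j" using poly_nat_le_power[of "P + 1"] by blast
  \<comment> \<open>Chosen so that the \<open>k\<close>-th power of the logarithmic factor costs at
    most \<open>t powr (\<epsilon> / 2)\<close>; \<open>real k + 1\<close> avoids a division by
    zero.\<close>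
  define \<delta> where "\<delta> = \<epsilon> / (2 * (real k + 1))"
  have \<delta>: "\<delta> > 0" "\<delta> * real k \<le> \<epsilon> / 2"
    using assms(1) by (auto simp: \<delta>_def field_simps)
  define D where "D = 1 + 1 / (\<delta> * ln 2)"
  have D: "D > 0" using \<delta>(1) by (simp add: D_def add_pos_pos)
  \<comment> \<open>One extra factor \<open>n + E\<close> beats the constant
    \<open>C * D ^ k\<close>, and \<open>E \<ge> 2\<close> lets it dominate
    \<open>n + 2\<close>.\<close>
  obtain E where E: "real E > C * D ^ k" "E \<ge> 2"
    using reals_Archimedean2[of "max 2 (C * D ^ k)"] by auto
  \<comment> \<open>Large enough for
    \<open>(n + E) ^ (j * k + 1) \<le> t powr (\<epsilon> / 2)\<close>.\<close>
  obtain d :: nat where d: "real d \<ge> 2 * (real (j * k) + 1) / \<epsilon>"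
    using real_arch_simple by blast
  define N where "N = [:E, 1:] ^ d"
  have N: "poly N n = (n + E) ^ d" for n by (simp add: N_def add.commute)
  show ?thesis
  proof (intro exI[of _ N] allI conjI)
    fix n
    define t where "t = real (poly N n)"
    have t: "t = (real n + real E) ^ d" by (simp add: t_def N)
    have t1: "t \<ge> 1" unfolding t using E(2) by (intro one_le_power) simp
    then show "poly N n > 0" by (simp add: t_def)
    have "(1 + real (poly P n)) ^ k \<le> ((real n + 2) ^ j) ^ k"
    proof (rule power_mono)
      have "real (poly (P + 1) n) \<le> real ((n + 2) ^ j)" using j by (rule of_nat_mono)
      then show "1 + real (poly P n) \<le> (real n + 2) ^ j" by (simp add: add.commute)
    qed simp
    also have "\<dots> \<le> (real n + real E) ^ (j * k)"
      unfolding power_mult[symmetric] using E(2) by (intro power_mono) auto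
    finally have P: "(1 + real (poly P n)) ^ k \<le> (real n + real E) ^ (j * k)" .
    have "(1 + log 2 t) ^ k \<le> (D * t powr \<delta>) ^ k"
      using one_plus_log_le_powr[OF \<delta>(1) t1] t1 by (intro power_mono) (auto simp: D_def)
    also have "\<dots> = D ^ k * t powr (\<delta> * real k)"
      using t1 by (simp add: power_mult_distrib powr_powr[symmetric] powr_realpow)
    also have "\<dots> \<le> D ^ k * t powr (\<epsilon> / 2)"
      using D \<delta>(2) t1 by (intro mult_left_mono powr_mono) auto
    finally have log: "(1 + log 2 t) ^ k \<le> D ^ k * t powr (\<epsilon> / 2)" .
    have "(real n + real E) ^ (j * k + 1) = (real n + real E) powr (real (j * k) + 1)"
      using E(2) by (subst powr_realpow[symmetric]) (auto simp: add.commute)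
    also have "\<dots> \<le> (real n + real E) powr (real d * (\<epsilon> / 2))"
      using d assms(1) E(2) by (intro powr_mono) (auto simp: field_simps)
    also have "\<dots> = t powr (\<epsilon> / 2)"
      unfolding t using E(2) by (subst powr_powr[symmetric]) (simp add: powr_realpow)
    finally have big: "(real n + real E) ^ (j * k + 1) \<le> t powr (\<epsilon> / 2)" .
    have "C * t powr (1 - \<epsilon>) * ((1 + real (poly P n)) * (1 + log 2 t)) ^ k =
        C * t powr (1 - \<epsilon>) * ((1 + real (poly P n)) ^ k * (1 + log 2 t) ^ k)"
      by (simp add: power_mult_distrib)
    also have "\<dots> \<le> C * t powr (1 - \<epsilon>) * ((real n + real E) ^ (j * k) * (D ^ k * t powr (\<epsilon> / 2)))"
      using assms(2) t1 P log E(2) by (intro mult_left_mono mult_mono) auto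
    also have "\<dots> = (C * D ^ k) * (real n + real E) ^ (j * k) * (t powr (1 - \<epsilon>) * t powr (\<epsilon> / 2))"
      by (simp add: algebra_simps)
    also have "\<dots> < (real n + real E) * (real n + real E) ^ (j * k) * (t powr (1 - \<epsilon>) * t powr (\<epsilon> / 2))"
      using E t1 by (intro mult_strict_right_mono) auto
    also have "\<dots> \<le> t powr (\<epsilon> / 2) * (t powr (1 - \<epsilon>) * t powr (\<epsilon> / 2))"
      using big by (intro mult_right_mono) auto
    also have "\<dots> = t" using t1 by (simp add: powr_add[symmetric])
    finally show "C * real (poly N n) powr (1 - \<epsilon>) *
        ((1 + real (poly P n)) * (1 + log 2 (real (poly N n)))) ^ k < real (poly N n)"
      unfolding t_def .
  qed
qed

section \<open>From the bound on the number of queries to short transcripts\<close>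

lemma bigo_powr_bound:
  assumes "b \<in> O(\<lambda>n. real n powr (1 - \<epsilon>))" "\<epsilon>' \<le> \<epsilon>" "\<epsilon>' \<le> 1"
  shows "\<exists>C \<ge> 1. \<forall>n :: nat. b n \<le> C * (real n + 1) powr (1 - \<epsilon>')"
proof -
  obtain c where c: "c > 0" "eventually (\<lambda>n. norm (b n) \<le> c * norm (real n powr (1 - \<epsilon>))) sequentially"
    using landau_o.bigE[OF assms(1)] by blast
  then obtain m where m: "\<And>n. n \<ge> m \<Longrightarrow> \<bar>b n\<bar> \<le> c * real n powr (1 - \<epsilon>)"
    by (auto simp: eventually_sequentially)
  define C where "C = 1 + c + (\<Sum>n<m. \<bar>b n\<bar>)"
  have sum: "(\<Sum>n<m. \<bar>b n\<bar>) \<ge> 0" by (intro sum_nonneg) simp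
  have C: "C \<ge> 1" "c \<le> C" using c(1) sum by (auto simp: C_def)
  have one: "(real n + 1) powr (1 - \<epsilon>') \<ge> 1" for n :: nat
    using assms(3) by (intro ge_one_powr_ge_zero) auto
  have "b n \<le> C * (real n + 1) powr (1 - \<epsilon>')" for n
  proof (cases "n < m")
    case True
    then have "\<bar>b n\<bar> \<le> (\<Sum>n<m. \<bar>b n\<bar>)" by (intro member_le_sum) auto
    then have "b n \<le> C" using c(1) by (simp add: C_def)
    also have "\<dots> \<le> C * (real n + 1) powr (1 - \<epsilon>')"
      using C(1) one[of n] by (simp add: mult_le_cancel_left1)
    finally show ?thesis .
  next
    case False
    have "real n powr (1 - \<epsilon>) \<le> (real n + 1) powr (1 - \<epsilon>')"
    proof (cases "n = 0")
      case False
      then have "real n powr (1 - \<epsilon>) \<le> real n powr (1 - \<epsilon>')"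
        using assms(2) by (intro powr_mono) auto
      also have "\<dots> \<le> (real n + 1) powr (1 - \<epsilon>')"
        using assms(3) by (intro powr_mono2) auto
      finally show ?thesis .
    qed simp
    then have "c * real n powr (1 - \<epsilon>) \<le> C * (real n + 1) powr (1 - \<epsilon>')"
      using C c(1) by (intro mult_mono) auto
    with m[of n] False show ?thesis by simp
  qed
  with C(1) show ?thesis by blast
qed

lemma length_foldr_entry:
  "length (foldr (entry R) qs v) = (\<Sum>q\<leftarrow>qs. 2 * length (fst q) + snd q + 3) + length v"
  by (induction qs) (auto simp: entry_def unary_def)

lemma length_transcript_bound:
  assumes "\<And>y p. (y, p) \<in> set qs \<Longrightarrow> length y + p \<le> m"
  shows "length (foldr (entry R) qs []) \<le> length qs * (2 * m + 3)"
proof -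
  have "2 * length (fst q) + snd q + 3 \<le> 2 * m + 3" if "q \<in> set qs" for q
    using assms[of "fst q" "snd q"] that by simp
  from sum_list_bound[OF this] show ?thesis unfolding length_foldr_entry by simp
qed

text \<open>The instance composed from \<open>t\<close> strings has size linear in \<open>t\<close>
  up to polylogarithmic and polynomial factors, so about \<open>t powr (1 - \<epsilon>)\<close>
  queries are asked. The length of an entry depends on the parameter alone, which is polynomial in
  \<open>n\<close> and \<open>log t\<close>. The product stays below a suitable
  \<open>t\<close>.\<close>

lemma short_transcripts:
  fixes g :: "bitstring list \<Rightarrow> param_inst" and M :: "nat poly"
  assumes size: "\<And>zs. zs \<noteq> [] \<Longrightarrow> real (size_inst c0 (g zs)) \<le> real (length zs) *
      poly a (log 2 (real (length zs))) * poly b (real (Max (length ` set zs)))"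
    and param: "\<And>zs. zs \<noteq> [] \<Longrightarrow> real (snd (g zs)) \<le>
      poly c (real (Max (length ` set zs)) + log 2 (real (length zs)))"
    and F: "\<And>p. real (F p) = poly h (real p)"
    and bound: "\<And>x p. real (length (ks (x, p))) \<le> B (size_inst c0 (x, p))"
    and queries: "\<And>x p y p'. (y, p') \<in> set (ks (x, p)) \<Longrightarrow> length y + p' \<le> F p"
    and B: "B \<in> O(\<lambda>n. real n powr (1 - \<epsilon>))" and \<epsilon>: "\<epsilon> > 0"
  shows "\<exists>N :: nat poly. (\<forall>n. poly N n > 0) \<and>
    (\<forall>n zs. length zs = poly N n \<longrightarrow> (\<forall>z \<in> set zs. length z \<le> poly M n) \<longrightarrow>
      length (foldr (entry R) (ks (g zs)) []) < poly N n)"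
proof -
  \<comment> \<open>A large \<open>\<epsilon>\<close> is reduced to at most 1/2, so that
    \<open>1 - \<epsilon>'\<close> is positive and the power is monotone in its base.\<close>
  define \<epsilon>' where "\<epsilon>' = min \<epsilon> (1 / 2)"
  have \<epsilon>': "\<epsilon>' > 0" "\<epsilon>' \<le> \<epsilon>" "\<epsilon>' < 1" using \<epsilon> by (auto simp: \<epsilon>'_def)
  obtain C0 where C0: "C0 \<ge> 1" "\<And>n. B n \<le> C0 * (real n + 1) powr (1 - \<epsilon>')"
    using bigo_powr_bound[OF B \<epsilon>'(2)] \<epsilon>'(3) by fastforce
  obtain Ca ka where Ca: "Ca \<ge> 1" "\<And>x. x \<ge> 0 \<Longrightarrow> \<bar>poly a x\<bar> \<le> Ca * (1 + x) ^ ka"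
    using poly_real_le_power by blast
  obtain Cb kb where Cb: "Cb \<ge> 1" "\<And>x. x \<ge> 0 \<Longrightarrow> \<bar>poly b x\<bar> \<le> Cb * (1 + x) ^ kb"
    using poly_real_le_power by blast
  obtain Cc kc where Cc: "Cc \<ge> 1" "\<And>x. x \<ge> 0 \<Longrightarrow> \<bar>poly c x\<bar> \<le> Cc * (1 + x) ^ kc"
    using poly_real_le_power by blast
  obtain Ch kh where Ch: "Ch \<ge> 1" "\<And>x. x \<ge> 0 \<Longrightarrow> \<bar>poly h x\<bar> \<le> Ch * (1 + x) ^ kh"
    using poly_real_le_power by blast
  define C1 where "C1 = Ca * Cb + 1"
  define C2 where "C2 = 2 * Ch * (1 + Cc) ^ kh + 3"
  define k1 where "k1 = ka + kb"
  define k2 where "k2 = kc * kh"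
  have C12: "C1 \<ge> 1" "C2 \<ge> 1"
    using Ca(1) Cb(1) Cc(1) Ch(1) by (auto simp: C1_def C2_def)
  obtain N :: "nat poly" where N: "\<And>n. poly N n > 0"
    "\<And>n. C0 * C1 * C2 * real (poly N n) powr (1 - \<epsilon>') *
       ((1 + real (poly M n)) * (1 + log 2 (real (poly N n)))) ^ (k1 + k2) < real (poly N n)"
    using ex_tuple_length[OF \<epsilon>'(1), of "C0 * C1 * C2" M "k1 + k2"] C0(1) C12 by auto
  have "length (foldr (entry R) (ks (g zs)) []) < poly N n"
    if zs: "length zs = poly N n" "\<And>z. z \<in> set zs \<Longrightarrow> length z \<le> poly M n" for n zs
  proof -
    define t where "t = real (poly N n)"
    define m where "m = real (Max (length ` set zs))"
    \<comment> \<open>A common bound for the arguments of all polynomials, so that each of them is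
      at most a constant times a power of \<open>X\<close>.\<close>
    define X where "X = (1 + real (poly M n)) * (1 + log 2 t)"
    have "zs \<noteq> []" using zs(1) N(1)[of n] by auto
    have t: "t \<ge> 1" "real (length zs) = t" using N(1)[of n] zs(1) by (auto simp: t_def)
    then have l: "log 2 t \<ge> 0" by simp
    have m: "0 \<le> m" "m \<le> real (poly M n)"
      using \<open>zs \<noteq> []\<close> zs(2) by (auto simp: m_def)
    have X: "X \<ge> 1" "1 + log 2 t \<le> X" "1 + m \<le> X" "1 + (m + log 2 t) \<le> X"
    proof -
      show "X \<ge> 1" using l by (simp add: X_def mult_ge1_I)
      show "1 + log 2 t \<le> X" using l by (simp add: X_def algebra_simps)
      show "1 + m \<le> X" using l m mult_nonneg_nonneg[of m "log 2 t"]
        by (simp add: X_def distrib_left) (smt (verit) mult_nonneg_nonneg)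
      show "1 + (m + log 2 t) \<le> X"
        using l m by (simp add: X_def algebra_simps) (smt (verit) mult_nonneg_nonneg)
    qed
    have "\<bar>poly a (log 2 t)\<bar> \<le> Ca * X ^ ka"
      using Ca X l by (intro order_trans[OF Ca(2)] mult_left_mono power_mono) auto
    moreover have "\<bar>poly b m\<bar> \<le> Cb * X ^ kb"
      using Cb X m by (intro order_trans[OF Cb(2)] mult_left_mono power_mono) auto
    ultimately have "\<bar>poly a (log 2 t)\<bar> * \<bar>poly b m\<bar> \<le> (Ca * X ^ ka) * (Cb * X ^ kb)"
      using Ca(1) X(1) by (intro mult_mono) auto
    then have ab: "\<bar>poly a (log 2 t) * poly b m\<bar> \<le> Ca * Cb * X ^ k1"
      by (simp add: abs_mult k1_def power_add mult_ac)
    define s where "s = size_inst c0 (g zs)"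
    have "real s \<le> t * (poly a (log 2 t) * poly b m)"
      using size[OF \<open>zs \<noteq> []\<close>] t(2) by (simp add: s_def m_def mult.assoc)
    also have "\<dots> \<le> t * (Ca * Cb * X ^ k1)"
      using ab t(1) by (intro mult_left_mono) auto
    \<comment> \<open>The \<open>+ 1\<close> stems from the bound on \<open>B\<close>; it is at most
      \<open>t * X ^ k1\<close>, whence the summand 1 in \<open>C1\<close>.\<close>
    finally have "real s + 1 \<le> t * (Ca * Cb * X ^ k1) + t * X ^ k1"
      using t(1) X(1) mult_mono[of 1 t 1 "X ^ k1"] by (simp add: one_le_power)
    then have s: "real s + 1 \<le> C1 * t * X ^ k1" by (simp add: C1_def algebra_simps)
    have "(real s + 1) powr (1 - \<epsilon>') \<le> (C1 * t * X ^ k1) powr (1 - \<epsilon>')"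
      using s \<epsilon>' by (intro powr_mono2) auto
    also have "\<dots> = C1 powr (1 - \<epsilon>') * t powr (1 - \<epsilon>') * (X ^ k1) powr (1 - \<epsilon>')"
      using C12 t(1) X(1) by (simp add: powr_mult)
    \<comment> \<open>Only the factor \<open>t\<close> needs the saving; the other bases are at
      least 1, so their exponent may be raised to 1.\<close>
    also have "\<dots> \<le> C1 powr 1 * t powr (1 - \<epsilon>') * (X ^ k1) powr 1"
      using C12 t(1) X(1) \<epsilon>' by (intro mult_mono powr_mono) (auto simp: one_le_power)
    finally have s': "(real s + 1) powr (1 - \<epsilon>') \<le> C1 * t powr (1 - \<epsilon>') * X ^ k1"
      using C12 X(1) by simp
    obtain y p where yp: "g zs = (y, p)" by fastforce
    have "real p \<le> \<bar>poly c (m + log 2 t)\<bar>"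
      using param[OF \<open>zs \<noteq> []\<close>] t(2) yp by (simp add: m_def)
    also have "\<dots> \<le> Cc * X ^ kc"
      using Cc X l m by (intro order_trans[OF Cc(2)] mult_left_mono power_mono) auto
    finally have "1 + real p \<le> (1 + Cc) * X ^ kc"
      using X(1) by (simp add: distrib_right one_le_power add_mono)
    then have "(1 + real p) ^ kh \<le> (1 + Cc) ^ kh * X ^ k2"
      by (simp add: k2_def power_mult power_mono flip: power_mult_distrib)
    moreover have "real (F p) \<le> Ch * (1 + real p) ^ kh"
      using Ch(2)[of "real p"] F[of p] by simp
    ultimately have "real (F p) \<le> Ch * ((1 + Cc) ^ kh * X ^ k2)"
      using Ch(1) by (smt (verit) mult_left_mono)
    then have "2 * real (F p) + 3 \<le> 2 * (Ch * ((1 + Cc) ^ kh * X ^ k2)) + 3 * X ^ k2"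
      using X(1) by (simp add: one_le_power add_mono)
    then have F': "2 * real (F p) + 3 \<le> C2 * X ^ k2" by (simp add: C2_def algebra_simps)
    have "real (length (foldr (entry R) (ks (g zs)) [])) \<le> real (length (ks (g zs)) * (2 * F p + 3))"
      unfolding yp using length_transcript_bound[OF queries] by (rule of_nat_mono)
    also have "\<dots> = real (length (ks (g zs))) * (2 * real (F p) + 3)" by simp
    also have "\<dots> \<le> (C0 * (C1 * t powr (1 - \<epsilon>') * X ^ k1)) * (C2 * X ^ k2)"
    proof (rule mult_mono)
      have "real (length (ks (g zs))) \<le> C0 * (real s + 1) powr (1 - \<epsilon>')"
        using order_trans[OF bound[of y p] C0(2)] yp by (simp add: s_def)
      also have "\<dots> \<le> C0 * (C1 * t powr (1 - \<epsilon>') * X ^ k1)"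
        using s' C0(1) by (intro mult_left_mono) auto
      finally show "real (length (ks (g zs))) \<le> C0 * (C1 * t powr (1 - \<epsilon>') * X ^ k1)" .
    qed (use F' C0(1) C12 X(1) in auto)
    also have "\<dots> = C0 * C1 * C2 * t powr (1 - \<epsilon>') * X ^ (k1 + k2)"
      by (simp add: power_add)
    also have "\<dots> < t" using N(2)[of n] by (simp add: t_def X_def)
    finally show ?thesis by (simp add: t_def)
  qed
  with N(1) show ?thesis by blast
qed

section \<open>Assembling kernel, composition and reductions\<close>

theorem theorem5:
  fixes c0 :: nat and R :: param_problem and L :: problem
  assumes "NP_hard L"
    and "\<exists>g. linear_OR_composition c0 L R g"
    and "\<not> class_NP \<subseteq> with_poly_advice class_coNP"
  shows "\<not> (\<exists>\<epsilon>::real. \<epsilon> > 0 \<and>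
      (\<exists>K f b. turing_kernel c0 R K f \<and> is_polynomial f \<and>
        query_bound c0 R K b \<and> b \<in> O(\<lambda>n. real n powr (1 - \<epsilon>))))"
proof
  assume "\<exists>\<epsilon>::real. \<epsilon> > 0 \<and>
      (\<exists>K f b. turing_kernel c0 R K f \<and> is_polynomial f \<and>
        query_bound c0 R K b \<and> b \<in> O(\<lambda>n. real n powr (1 - \<epsilon>)))"
  then obtain \<epsilon> :: real and K F B where \<epsilon>: "\<epsilon> > 0" and kernel: "turing_kernel c0 R K F"
    and "is_polynomial F" and query: "query_bound c0 R K B"
    and B: "B \<in> O(\<lambda>n. real n powr (1 - \<epsilon>))" by blast
  then obtain h where h: "\<And>p. real (F p) = poly h (real p)"
    unfolding is_polynomial_def by blast
  from kernel obtain qk :: "nat poly" where "\<forall>x p. \<exists>t qs s'.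
      exec R K (load_inst (x, p)) t qs s' \<and> t \<le> poly qk (size_inst c0 (x, p)) \<and>
      s' 0 = [(x, p) \<in> R] \<and> (\<forall>(y, p') \<in> set qs. length y + p' \<le> F p)"
    unfolding turing_kernel_def by blast
  then have "\<forall>q. \<exists>qs t s'. exec R K (load_inst q) t qs s' \<and> t \<le> poly qk (size_inst c0 q) \<and>
      s' 0 = [q \<in> R] \<and> (\<forall>(y, p') \<in> set qs. length y + p' \<le> F (snd q))"
    by (metis prod.collapse)
  \<comment> \<open>With the queries chosen as a function of the instance, the transcript becomes a
    function of the composed list.\<close>
  then obtain ks where ks: "\<And>q. \<exists>t s'. exec R K (load_inst q) t (ks q) s' \<and>
      t \<le> poly qk (size_inst c0 q) \<and> s' 0 = [q \<in> R] \<and>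
      (\<forall>(y, p') \<in> set (ks q). length y + p' \<le> F (snd q))" by metis
  from assms(2) obtain g where "linear_OR_composition c0 L R g" by blast
  note or_composition = this[unfolded linear_OR_composition_def]
  obtain cg and qg :: "nat poly" where
    cg: "\<And>xs. xs \<noteq> [] \<Longrightarrow> \<exists>t s'. runs cg (load [encode_list xs]) t s' \<and>
      t \<le> poly qg (\<Sum>x\<leftarrow>xs. length x + 1) \<and> g xs = (s' 0, length (s' 1))"
    using conjunct1[OF or_composition] by blast
  obtain a b :: "real poly" where
    size: "\<And>zs. zs \<noteq> [] \<Longrightarrow> real (size_inst c0 (g zs)) \<le> real (length zs) *
      poly a (log 2 (real (length zs))) * poly b (real (Max (length ` set zs)))"
    using conjunct1[OF conjunct2[OF or_composition]] by blast
  obtain c :: "real poly" where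
    param: "\<And>zs. zs \<noteq> [] \<Longrightarrow> real (snd (g zs)) \<le>
      poly c (real (Max (length ` set zs)) + log 2 (real (length zs)))"
    using conjunct1[OF conjunct2[OF conjunct2[OF or_composition]]] by blast
  have g: "g zs \<in> R \<longleftrightarrow> (\<exists>z \<in> set zs. z \<in> L)" if "zs \<noteq> []" for zs
    using conjunct2[OF conjunct2[OF conjunct2[OF or_composition]]] that by blast
  have "A \<in> with_poly_advice class_coNP" if "A \<in> class_NP" for A
  proof -
    from that assms(1) obtain f where "polytime_computable f" and f: "\<And>x. x \<in> A \<longleftrightarrow> f x \<in> L"
      unfolding NP_hard_def karp_reducible_def by blast
    then obtain cf and qf :: "nat poly" where
      cf: "\<And>x. \<exists>t s'. runs cf (load [x]) t s' \<and> t \<le> poly qf (length x) \<and> s' 0 = f x"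
      unfolding polytime_computable_def by blast
    \<comment> \<open>The reduction depends on \<open>A\<close>, hence so do the tuple length and
      the advice; kernel and composition stay the same.\<close>
    interpret kernel_setting c0 R f cf qf g cg qg K ks qk
      using cf cg ks by unfold_locales blast+
    have bound: "real (length (ks (x, p))) \<le> B (size_inst c0 (x, p))" for x p
      using query ks unfolding query_bound_def by blast
    have queries: "length y + p' \<le> F p" if "(y, p') \<in> set (ks (x, p))" for x p y p'
      using ks[of "(x, p)"] that by auto
    have "\<exists>N :: nat poly. (\<forall>n. poly N n > 0) \<and>
      (\<forall>n zs. length zs = poly N n \<longrightarrow> (\<forall>z \<in> set zs. length z \<le> poly reduction_poly n) \<longrightarrow>
        length (transcript zs) < poly N n)"
      unfolding transcript_def
      by (rule short_transcripts)
        (erule size, erule param, rule h, rule bound, erule queries, rule B, rule \<epsilon>)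
    then obtain N :: "nat poly" where "\<And>n. poly N n > 0"
      "\<And>n zs. length zs = poly N n \<Longrightarrow> (\<And>z. z \<in> set zs \<Longrightarrow> length z \<le> poly reduction_poly n) \<Longrightarrow>
        length (transcript zs) < poly N n"
      by blast
    with g f show ?thesis by (intro coNP_poly_advice) auto
  qed
  with assms(3) show False by blast
qed

end
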